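(* In the setting of the context, let the current snapshot be $\boldsymbol{x}=\boldsymbol{x}^*(\alpha)+\boldsymbol{z}$ with $\boldsymbol{z}\sim\mathcal{N}(\boldsymbol{0},C(\alpha))$, and let $\boldsymbol{b}=\boldsymbol{x}^*(\alpha_0)+\boldsymbol{\epsilon}$ with $\boldsymbol{\epsilon}\sim\mathcal{N}(\boldsymbol{0},C(\alpha_0)/\ell)$ independent of $\boldsymbol{z}$ (the average of $\ell\ge1$ independent stationary snapshots at $\alpha_0$), where $\alpha_0$ is fixed as $\alpha\to\alpha_{\mathrm c}^-$. Let $\boldsymbol{y}^\Delta=\boldsymbol{x}-\boldsymbol{b}$, $V_\Delta=\operatorname{Var}(\boldsymbol{y}^\Delta)$, and $\mathrm{CV}_\Delta=\sqrt{V_\Delta}/|\overline{y^\Delta}|$. Assume that $\sigma_{\mathrm{eff,c}}^2=\boldsymbol{w}_{\mathrm c}^\top BB^\top\boldsymbol{w}_{\mathrm c}>0$ and that, for $\alpha<\alpha_{\mathrm c}$ sufficiently close to $\alpha_{\mathrm c}$, $\Pr(\bar x=0)=0$ and $\Pr(\overline{y^\Delta}=0)=0$. Let $\rho_{\mathrm c}=(\boldsymbol{1}^\top\boldsymbol{v}_{\mathrm c})^2/N$. Then, in probability as $\alpha\to\alpha_{\mathrm c}^-$: (i) if $0<\rho_{\mathrm c}<1$, then $\mathrm{CV}_\Delta\to\sqrt{\dfrac{N(1-\rho_{\mathrm c})}{(N-1)\rho_{\mathrm c}}}$; (ii) if $\rho_{\mathrm c}=1$, then $\mathrm{CV}_\Delta\to0$;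 (iii) if $\rho_{\mathrm c}=0$, then $\mathrm{CV}_\Delta\to\infty$ in probability.
   Context: Setting. $N\ge2$. Consider the It\^o SDE $\mathrm d\boldsymbol{x}=F(\boldsymbol{x};\alpha)\,\mathrm dt+B\,\mathrm d\boldsymbol{W}$ in $\mathbb{R}^N$, with $B\in\mathbb{R}^{N\times m}$ constant, $\boldsymbol{W}$ an $m$-dimensional standard Wiener process, and $F$ sufficiently smooth in $(\boldsymbol{x},\alpha)$ ($C^2$ in a neighborhood of the equilibrium branch, including its endpoint at $\alpha_{\mathrm c}$, suffices). $\boldsymbol{x}^*(\alpha)$ is a branch of equilibria, $F(\boldsymbol{x}^*(\alpha);\alpha)=\boldsymbol{0}$, asymptotically stable for $\alpha<\alpha_{\mathrm c}$ (in particular at $\alpha_0<\alpha_{\mathrm c}$), and $M(\alpha)=-\frac{\partial F}{\partial\boldsymbol{x}}\big|_{\boldsymbol{x}=\boldsymbol{x}^*(\alpha)}$. $C=C(\alpha)$ is the stationary covariance of the linearized process $\mathrm d\boldsymbol{z}=-M\boldsymbol{z}\,\mathrm dt+B\,\mathrm d\boldsymbol{W}$, i.e. the solution of $MC+CM^\top=BB^\top$. Regular simple real critical eigenvalue assumption (in force). As $\alpha\to\alpha_{\mathrm c}^-$, $\boldsymbol{x}^*(\alpha)$ has a finite limit. For $\alpha<\alpha_{\mathrm c}$ close to $\alpha_{\mathrm c}$, $M(\alpha)$ is diagonalizable over $\mathbb{C}$ with all eigenvalues of positive real part; the eigenvalue $\lambda_1(\alpha)$ of smallest real part is real and simple, $\lambda_1(\alpha)>0$,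 $\lambda_1(\alpha)\to0$, and $\operatorname{Re}\lambda_k(\alpha)\ge\delta>0$ for $k=2,\dots,N$, with $\delta$ independent of $\alpha$. Real right and left eigenvectors $\boldsymbol{v}(\alpha),\boldsymbol{w}(\alpha)$ are chosen with $M\boldsymbol{v}=\lambda_1\boldsymbol{v}$, $\boldsymbol{w}^\top M=\lambda_1\boldsymbol{w}^\top$, $\|\boldsymbol{v}\|_2=1$, $\boldsymbol{w}^\top\boldsymbol{v}=1$, and they have finite limits $\boldsymbol{v}_{\mathrm c},\boldsymbol{w}_{\mathrm c}$ as $\alpha\to\alpha_{\mathrm c}^-$. Notation: $\bar u=N^{-1}\sum_iu_i$ and $\operatorname{Var}(\boldsymbol{u})=\frac1{N-1}\sum_i(u_i-\bar u)^2$ for $\boldsymbol{u}\in\mathbb{R}^N$. "$\to\infty$ in probability" means that for every $K$, the probability of exceeding $K$ tends to $1$. *)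

theory Defs
  imports
    "HOL-Probability.Probability"
    "HOL-Computational_Algebra.Polynomial"
begin

(* Twice continuous (Frechet) differentiability; intended for open U. *)
definition C2_on :: "'a::real_normed_vector set \<Rightarrow> ('a \<Rightarrow> 'b::real_normed_vector) \<Rightarrow> bool" where
  "C2_on U f \<longleftrightarrow>
    (\<exists>(f' :: 'a \<Rightarrow> 'a \<Rightarrow>\<^sub>L 'b) (f'' :: 'a \<Rightarrow> 'a \<Rightarrow>\<^sub>L ('a \<Rightarrow>\<^sub>L 'b)).
       (\<forall>p\<in>U. (f has_derivative blinfun_apply (f' p)) (at p)) \<and>
       (\<forall>p\<in>U. (f' has_derivative blinfun_apply (f'' p)) (at p)) \<and>
       continuous_on U f'')"

definition ode_solution_on :: "('a::real_normed_vector \<Rightarrow> 'a) \<Rightarrow> real set \<Rightarrow> (real \<Rightarrow> 'a) \<Rightarrow> bool" where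
  "ode_solution_on f T x \<longleftrightarrow> (\<forall>t\<in>T. (x has_vector_derivative f (x t)) (at t within T))"

(* Stability in the sense of Lyapunov together with local attractivity.  The stability clause
   also covers solutions that exist on a bounded time interval only, so that a blow-up near p
   is excluded as well. *)
definition asymptotically_stable :: "('a::real_normed_vector \<Rightarrow> 'a) \<Rightarrow> 'a \<Rightarrow> bool" where
  "asymptotically_stable f p \<longleftrightarrow>
    f p = 0 \<and>
    (\<forall>e>0. \<exists>d>0. \<forall>x T. T > 0 \<longrightarrow> ode_solution_on f {0..<T} x \<longrightarrow> dist (x 0) p < d \<longrightarrow>
       (\<forall>t\<in>{0..<T}. dist (x t) p < e)) \<and>
    (\<exists>d>0. \<forall>x. ode_solution_on f {0..} x \<longrightarrow> dist (x 0) p < d \<longrightarrow> (x \<longlongrightarrow> p) at_top)"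

definition drift_matrix :: "(real^'n \<Rightarrow> real \<Rightarrow> real^'n) \<Rightarrow> (real \<Rightarrow> real^'n) \<Rightarrow> real \<Rightarrow> real^'n^'n" where
  "drift_matrix F xs \<alpha> = - jacobian (\<lambda>x. F x \<alpha>) (at (xs \<alpha>))"

definition complex_matrix :: "real^'n^'m \<Rightarrow> complex^'n^'m" where
  "complex_matrix A = map_matrix complex_of_real A"

definition diagonalizable :: "('a::field)^'n^'n \<Rightarrow> bool" where
  "diagonalizable A \<longleftrightarrow>
    (\<exists>P D :: 'a^'n^'n. invertible P \<and> (\<forall>i j. i \<noteq> j \<longrightarrow> D $ i $ j = 0) \<and> A = P ** D ** matrix_inv P)"

definition is_eigenvalue :: "('a::field)^'n^'n \<Rightarrow> 'a \<Rightarrow> bool" where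
  "is_eigenvalue A \<mu> \<longleftrightarrow> (\<exists>u. u \<noteq> 0 \<and> A *v u = \<mu> *s u)"

definition characteristic_poly :: "('a::field)^'n^'n \<Rightarrow> 'a poly" where
  "characteristic_poly A = det (mat [:0, 1:] - map_matrix (\<lambda>a. [:a:]) A)"

definition is_simple_eigenvalue :: "('a::field)^'n^'n \<Rightarrow> 'a \<Rightarrow> bool" where
  "is_simple_eigenvalue A \<mu> \<longleftrightarrow> is_eigenvalue A \<mu> \<and> order \<mu> (characteristic_poly A) = 1"

definition pos_semidef :: "real^'n^'n \<Rightarrow> bool" where
  "pos_semidef C \<longleftrightarrow> transpose C = C \<and> (\<forall>u. 0 \<le> u \<bullet> (C *v u))"

(* The covariance of the stationary law of  dz = - M z dt + B dW. *)
definition stationary_covariance :: "real^'n^'n \<Rightarrow> real^'m^'n \<Rightarrow> real^'n^'n \<Rightarrow> bool" where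
  "stationary_covariance M B C \<longleftrightarrow>
    pos_semidef C \<and> M ** C + C ** transpose M = B ** transpose B"

(* The Gaussian law on the real line with standard deviation s \<ge> 0; a point mass if s = 0. *)
definition gaussian :: "real \<Rightarrow> real \<Rightarrow> real measure" where
  "gaussian \<mu> s = (if s = 0 then return borel \<mu> else density lborel (\<lambda>x. ennreal (normal_density \<mu> s x)))"

(* Z has law N(\<mu>, C), where C may be singular: every linear functional of Z is Gaussian with the
   corresponding mean and variance. *)
definition multivariate_normal ::
    "'a measure \<Rightarrow> ('a \<Rightarrow> real^'n) \<Rightarrow> real^'n \<Rightarrow> real^'n^'n \<Rightarrow> bool" where
  "multivariate_normal P Z \<mu> C \<longleftrightarrow>
    Z \<in> borel_measurable P \<and> pos_semidef C \<and>
    (\<forall>u. distr P borel (\<lambda>\<omega>. u \<bullet> Z \<omega>) = gaussian (u \<bullet> \<mu>) (sqrt (u \<bullet> (C *v u))))"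

definition avg :: "real^'n \<Rightarrow> real" where
  "avg u = (\<Sum>i\<in>UNIV. u $ i) / real CARD('n)"

definition sample_var :: "real^'n \<Rightarrow> real" where
  "sample_var u = (\<Sum>i\<in>UNIV. (u $ i - avg u)\<^sup>2) / (real CARD('n) - 1)"

definition coeff_var :: "real^'n \<Rightarrow> real" where
  "coeff_var u = sqrt (sample_var u) / \<bar>avg u\<bar>"

(* Convergence in probability along a filter, where each random variable X a may live on its own
   probability space P a. *)
definition tendsto_in_prob ::
    "('i \<Rightarrow> 'a measure) \<Rightarrow> ('i \<Rightarrow> 'a \<Rightarrow> real) \<Rightarrow> real \<Rightarrow> 'i filter \<Rightarrow> bool" where
  "tendsto_in_prob P X c G \<longleftrightarrow>
    (\<forall>e>0. ((\<lambda>a. measure (P a) {\<omega> \<in> space (P a). \<bar>X a \<omega> - c\<bar> > e}) \<longlongrightarrow> 0) G)"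

definition tendsto_infinity_in_prob ::
    "('i \<Rightarrow> 'a measure) \<Rightarrow> ('i \<Rightarrow> 'a \<Rightarrow> real) \<Rightarrow> 'i filter \<Rightarrow> bool" where
  "tendsto_infinity_in_prob P X G \<longleftrightarrow>
    (\<forall>K. ((\<lambda>a. measure (P a) {\<omega> \<in> space (P a). X a \<omega> > K}) \<longlongrightarrow> 1) G)"

end

theory Submission
  imports Defs
begin

text \<open>
  The variance of \<open>w \<bullet> z\<close> is \<open>w \<bullet> (B B\<^sup>T w) / (2 \<lambda>\<^sub>1)\<close>, which diverges, whereas the variance of
  \<open>u \<bullet> z\<close> stays bounded for \<open>u\<close> orthogonal to \<open>v\<close>. Hence \<open>y / (w \<bullet> z)\<close> tends to \<open>v\<^sub>c\<close> in
  probability, and the coefficient of variation is scale invariant and continuous at \<open>v\<^sub>c\<close> unless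
  \<open>v\<^sub>c\<close> has mean zero.

  The uniform bound needs no convergence of the noncritical eigenvectors, which may degenerate in
  the limit. Extend the covariance to a Hermitian form \<open>q\<close> on complex covectors. If \<open>Re d \<ge> \<delta>\<close>, the
  Lyapunov equation bounds \<open>q u\<close> by \<open>q (u M - d u)\<close> and \<open>|u|\<^sup>2\<close>. Applying \<open>u \<mapsto> u M - d u\<close> once for
  each noncritical eigenvalue \<open>d\<close> annihilates every \<open>u\<close> orthogonal to \<open>v\<close>, because \<open>M\<close> is
  diagonalizable.
\<close>

subsection \<open>Variance in the noncritical directions\<close>

lemma map_matrix_matrix_mult:
  fixes A :: "'a::comm_semiring_1^'n^'m" and B :: "'a^'k^'n"
  assumes "f 0 = 0" "\<And>x y. f (x + y) = f x + f y" "\<And>x y. f (x * y) = f x * (f y :: 'b::comm_semiring_1)"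
  shows "map_matrix f (A ** B) = map_matrix f A ** map_matrix f B"
proof -
  have "f (sum g S) = (\<Sum>x\<in>S. f (g x))" for g and S :: "'n set"
    by (induction S rule: infinite_finite_induct) (auto simp: assms)
  then show ?thesis
    by (simp add: vec_eq_iff matrix_matrix_mult_def assms)
qed

lemma matrix_diff_distrib:
  fixes A :: "'a::comm_ring_1^'n^'m"
  shows "A ** (B - C) = A ** B - A ** C" "(B' - C') ** A = B' ** A - C' ** A"
  by (simp_all add: vec_eq_iff matrix_matrix_mult_def sum_subtractf algebra_simps)

lemma matrix_inv_inverse:
  fixes P :: "'a::field^'n^'n"
  assumes "invertible P"
  shows "P ** matrix_inv P = mat 1" "matrix_inv P ** P = mat 1"
  using assms someI_ex[of "\<lambda>P'. P ** P' = mat 1 \<and> P' ** P = mat 1"]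
  unfolding invertible_def matrix_inv_def by auto

text \<open>The scalar polynomial matrix \<open>?X\<close> commutes with the constant matrix
  \<open>P\<close>, so conjugation by \<open>P\<close> can be pulled out of
  \<open>?X - P D P^-1\<close>. The determinants of \<open>P\<close> and its inverse cancel, and a
  diagonal determinant remains.\<close>

lemma characteristic_poly_diagonalized:
  fixes P D :: "'a::field^'n^'n"
  assumes "invertible P" and diag: "\<And>i j. i \<noteq> j \<Longrightarrow> D $ i $ j = 0"
  shows "characteristic_poly (P ** D ** matrix_inv P) = (\<Prod>i\<in>UNIV. [:- (D $ i $ i), 1:])"
proof -
  let ?c = "map_matrix (\<lambda>a::'a. [:a:])" and ?X = "mat [:0, 1:] :: 'a poly^'n^'n"
  have hom: "?c (A ** B) = ?c A ** ?c B" for A B :: "'a^'n^'n"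
    by (rule map_matrix_matrix_mult) (auto simp: mult.commute)
  have inv: "?c P ** ?c (matrix_inv P) = mat 1"
    unfolding hom[symmetric] matrix_inv_inverse[OF assms(1)] by (simp add: vec_eq_iff mat_def one_pCons)
  have comm: "?c P ** ?X = ?X ** ?c P"
    by (simp add: vec_eq_iff matrix_matrix_mult_def mat_def if_distrib if_distribR sum.delta sum.delta' mult.commute cong: if_cong)
  have "?X - ?c (P ** D ** matrix_inv P) = ?c P ** (?X - ?c D) ** ?c (matrix_inv P)"
  proof -
    have "?X = ?X ** (?c P ** ?c (matrix_inv P))" by (simp add: inv)
    also have "\<dots> = ?c P ** ?X ** ?c (matrix_inv P)" by (simp add: matrix_mul_assoc comm)
    finally show ?thesis
      by (simp add: hom matrix_diff_distrib)
  qed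
  then have "characteristic_poly (P ** D ** matrix_inv P)
      = det (?c P) * det (?X - ?c D) * det (?c (matrix_inv P))"
    unfolding characteristic_poly_def by (simp add: det_mul)
  also have "\<dots> = det (?c P ** ?c (matrix_inv P)) * det (?X - ?c D)"
    by (simp add: det_mul)
  also have "\<dots> = det (?X - ?c D)" by (simp add: inv)
  also have "\<dots> = (\<Prod>i\<in>UNIV. [:- (D $ i $ i), 1:])"
    by (subst det_diagonal) (auto simp: mat_def diag)
  finally show ?thesis .
qed

text \<open>Two diagonal positions carrying \<open>\<mu>\<close> would make the square of the linear
  factor divide the characteristic polynomial, against order 1. Applied to the critical eigenvalue,
  this puts every other diagonal entry under the spectral gap.\<close>

lemma simple_eigenvalue_index_unique:
  fixes P D :: "'a::field^'n^'n"
  assumes "invertible P" "\<And>i j. i \<noteq> j \<Longrightarrow> D $ i $ j = 0"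
    and "is_simple_eigenvalue (P ** D ** matrix_inv P) \<mu>" and "D $ i $ i = \<mu>" "D $ j $ j = \<mu>"
  shows "i = j"
proof (rule ccontr)
  assume "i \<noteq> j"
  let ?p = "\<Prod>k\<in>UNIV. [:- (D $ k $ k), 1:]"
  have "[:- \<mu>, 1:] ^ 2 = (\<Prod>k\<in>{i, j}. [:- (D $ k $ k), 1:])"
    using \<open>i \<noteq> j\<close> assms(4,5) by (simp add: power2_eq_square)
  also have "\<dots> dvd ?p" by (rule prod_dvd_prod_subset) auto
  finally have "[:- \<mu>, 1:] ^ 2 dvd ?p" .
  moreover have "?p \<noteq> 0" by (simp add: prod_zero_iff)
  moreover have "order \<mu> ?p = 1"
    using assms(3) characteristic_poly_diagonalized[OF assms(1,2)] by (simp add: is_simple_eigenvalue_def)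
  ultimately show False by (simp add: order_divides)
qed

section \<open>Hermitian extension of the covariance and the Lyapunov equation\<close>

definition Re_vec :: "complex^'n \<Rightarrow> real^'n" where "Re_vec u = (\<chi> i. Re (u $ i))"
definition Im_vec :: "complex^'n \<Rightarrow> real^'n" where "Im_vec u = (\<chi> i. Im (u $ i))"

text \<open>For symmetric \<open>X\<close> this is the value of \<open>u* X u\<close>: the mixed
  terms in the real and imaginary parts cancel. The split keeps it real-valued and leaves only real
  quadratic forms to estimate.\<close>

definition hermitian_form :: "real^'n^'n \<Rightarrow> complex^'n \<Rightarrow> real" where
  "hermitian_form X u = Re_vec u \<bullet> (X *v Re_vec u) + Im_vec u \<bullet> (X *v Im_vec u)"

lemma norm_complex_vec: "(norm u)\<^sup>2 = (norm (Re_vec u))\<^sup>2 + (norm (Im_vec u))\<^sup>2"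
  by (simp add: norm_vec_def L2_set_def Re_vec_def Im_vec_def sum_nonneg real_sqrt_pow2
      sum.distrib[symmetric] cmod_power2)

lemma hermitian_form_nonneg: "pos_semidef X \<Longrightarrow> 0 \<le> hermitian_form X u"
  by (simp add: pos_semidef_def hermitian_form_def)

lemma pos_semidef_inner_commute: "pos_semidef X \<Longrightarrow> u \<bullet> (X *v u') = u' \<bullet> (X *v u)"
  by (metis pos_semidef_def dot_lmul_matrix inner_commute transpose_matrix_vector)

lemma Re_Im_vector_matrix_mult:
  "Re_vec (u v* complex_matrix M) = Re_vec u v* M"
  "Im_vec (u v* complex_matrix M) = Im_vec u v* M"
  by (simp_all add: Re_vec_def Im_vec_def complex_matrix_def vector_matrix_mult_def vec_eq_iff)

lemma Re_Im_scale_diff: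
  "Re_vec (u - d *s u') = Re_vec u - Re d *\<^sub>R Re_vec u' + Im d *\<^sub>R Im_vec u'"
  "Im_vec (u - d *s u') = Im_vec u - Re d *\<^sub>R Im_vec u' - Im d *\<^sub>R Re_vec u'"
  by (simp_all add: Re_vec_def Im_vec_def vec_eq_iff algebra_simps)

text \<open>The two terms of the Lyapunov equation contribute equally, by symmetry of
  \<open>X\<close>. For a left eigenvector \<open>p\<close> of \<open>M\<close> with eigenvalue
  \<open>lam\<close> the right-hand side is \<open>2 * lam\<close> times the variance of the
  projection onto \<open>p\<close>, which yields the divergence of the critical variance.\<close>

lemma lyapunov_quadratic:
  fixes M X Q :: "real^'n^'n"
  assumes X: "pos_semidef X" and lyap: "M ** X + X ** transpose M = Q"
  shows "p \<bullet> (Q *v p) = 2 * ((p v* M) \<bullet> (X *v p))"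
proof -
  have "p \<bullet> (Q *v p) = p \<bullet> (M *v (X *v p)) + p \<bullet> (X *v (p v* M))"
    unfolding lyap[symmetric]
    by (simp add: matrix_vector_mult_add_rdistrib inner_add_right matrix_vector_mul_assoc[symmetric])
  then show ?thesis
    by (simp add: dot_lmul_matrix pos_semidef_inner_commute[OF X, of p])
qed

text \<open>Write \<open>u'\<close> for \<open>u M - d u\<close> and \<open>q\<close> for the form
  of \<open>X\<close>. The Lyapunov equation turns twice the real part of the pairing of
  \<open>u'\<close> with \<open>u\<close> into the form of \<open>Q\<close> at \<open>u\<close>
  minus \<open>2 * Re d * q u\<close>. Positivity of \<open>q (u' + \<delta> u)\<close> bounds that
  pairing from below at the price of \<open>q u' / \<delta> + \<delta> * q u\<close>, and
  \<open>Re d \<ge> \<delta>\<close> absorbs the last term.\<close>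

lemma lyapunov_step:
  fixes M X Q :: "real^'n^'n"
  assumes X: "pos_semidef X" and lyap: "M ** X + X ** transpose M = Q"
    and \<delta>: "\<delta> > 0" "Re d \<ge> \<delta>"
  shows "\<delta> * hermitian_form X u \<le> hermitian_form Q u + hermitian_form X (u v* complex_matrix M - d *s u) / \<delta>"
proof -
  let ?u' = "u v* complex_matrix M - d *s u"
  define a b where "a = Re_vec u" and "b = Im_vec u"
  define a' b' where "a' = Re_vec ?u'" and "b' = Im_vec ?u'"
  have a': "a' = a v* M - Re d *\<^sub>R a + Im d *\<^sub>R b" and b': "b' = b v* M - Re d *\<^sub>R b - Im d *\<^sub>R a"
    by (simp_all add: a'_def b'_def a_def b_def Re_Im_scale_diff Re_Im_vector_matrix_mult)
  have sym: "p \<bullet> (X *v q) = q \<bullet> (X *v p)" for p q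
    by (rule pos_semidef_inner_commute[OF X])
  note quad = lyapunov_quadratic[OF X lyap]
  \<comment> \<open>The contributions of \<open>Im d\<close> cancel because \<open>X\<close> is
    symmetric, so only \<open>Re d\<close> survives.\<close>
  have cross: "2 * (a' \<bullet> (X *v a) + b' \<bullet> (X *v b)) = hermitian_form Q u - 2 * Re d * hermitian_form X u"
    unfolding hermitian_form_def a_def[symmetric] b_def[symmetric] quad a' b'
    by (simp add: algebra_simps sym[of b a])
  have "0 \<le> (a' + \<delta> *\<^sub>R a) \<bullet> (X *v (a' + \<delta> *\<^sub>R a)) + (b' + \<delta> *\<^sub>R b) \<bullet> (X *v (b' + \<delta> *\<^sub>R b))"
    using X by (simp add: pos_semidef_def)
  also have "\<dots> = hermitian_form X ?u' + \<delta> * (2 * (a' \<bullet> (X *v a) + b' \<bullet> (X *v b))) + \<delta>\<^sup>2 * hermitian_form X u"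
    unfolding hermitian_form_def a_def[symmetric] b_def[symmetric] a'_def[symmetric] b'_def[symmetric]
    by (simp add: matrix_vector_right_distrib matrix_vector_mult_scaleR algebra_simps sym[of a a'] sym[of b b'] power2_eq_square)
  finally have "0 \<le> hermitian_form X ?u' / \<delta> + hermitian_form Q u - 2 * Re d * hermitian_form X u + \<delta> * hermitian_form X u"
    unfolding cross using \<delta>(1) by (simp add: field_simps power2_eq_square)
  moreover have "\<delta> * hermitian_form X u \<le> Re d * hermitian_form X u"
    using \<delta> hermitian_form_nonneg[OF X] by (intro mult_right_mono) auto
  ultimately show ?thesis by linarith
qed

text \<open>Induction on a set \<open>S\<close> containing the support of \<open>u P\<close>.
  Passing from \<open>u\<close> to \<open>u M - d i u\<close> multiplies coordinate \<open>j\<close>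
  by \<open>d j - d i\<close>, so coordinate \<open>i\<close> dies and no new one appears. The new
  covector has norm at most \<open>2 * m\<close> times the old one, and \<open>lyapunov_step\<close>
  turns a bound \<open>K\<close> for it into the iterated expression for \<open>u\<close>. The
  iteration starts at 0 because empty support forces \<open>u = 0\<close>. The size of
  \<open>P\<close> or of its inverse never enters the constant, so the bound stays uniform even if
  the eigenbasis degenerates.\<close>

lemma noncritical_variance_bound_coordinates:
  fixes M X Q :: "real^'n^'n" and P :: "complex^'n^'n"
  assumes X: "pos_semidef X" and lyap: "M ** X + X ** transpose M = Q" and \<delta>: "\<delta> > 0"
    and inj: "\<And>u. u v* P = 0 \<Longrightarrow> u = 0"
    and coord: "\<And>u i. ((u v* complex_matrix M) v* P) $ i = d i * (u v* P) $ i"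
    and m: "\<And>u. norm (u v* complex_matrix M) \<le> m * norm u" "\<And>i. norm (d i) \<le> m"
    and \<kappa>: "0 \<le> \<kappa>" "\<And>u. hermitian_form Q u \<le> \<kappa> * (norm u)\<^sup>2"
    and "finite S" "\<And>i. i \<in> S \<Longrightarrow> Re (d i) \<ge> \<delta>" "\<And>i. i \<notin> S \<Longrightarrow> (u v* P) $ i = 0"
  shows "hermitian_form X u \<le> ((\<lambda>K. (\<kappa> + (2 * m)\<^sup>2 * K / \<delta>) / \<delta>) ^^ card S) 0 * (norm u)\<^sup>2"
  using assms(10-12)
proof (induction S arbitrary: u rule: finite_induct)
  case empty
  then have "u v* P = 0" by (simp add: vec_eq_iff)
  then show ?case using inj[of u] by (simp add: hermitian_form_def Re_vec_def Im_vec_def zero_vec_def[symmetric])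
next
  case (insert i S)
  let ?u' = "u v* complex_matrix M - d i *s u"
  let ?K = "((\<lambda>K. (\<kappa> + (2 * m)\<^sup>2 * K / \<delta>) / \<delta>) ^^ card S) 0"
  have "0 \<le> m" using m(2)[of i] norm_ge_zero order_trans by blast
  have "0 \<le> ((\<lambda>K. (\<kappa> + (2 * m)\<^sup>2 * K / \<delta>) / \<delta>) ^^ n) 0" for n
    using \<kappa>(1) \<delta> by (induction n) auto
  then have "?K \<ge> 0" .
  have *: "(?u' v* P) $ j = (d j - d i) * (u v* P) $ j" for j
  proof -
    have "(?u' v* P) $ j = ((u v* complex_matrix M) v* P) $ j - d i * (u v* P) $ j"
      by (simp add: vector_matrix_mult_def sum_subtractf sum_distrib_left algebra_simps)
    then show ?thesis unfolding coord by (simp add: algebra_simps)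
  qed
  have IH: "hermitian_form X ?u' \<le> ?K * (norm ?u')\<^sup>2"
  proof (rule insert.IH)
    show "Re (d j) \<ge> \<delta>" if "j \<in> S" for j using insert.prems(1) that by auto
    show "(?u' v* P) $ j = 0" if "j \<notin> S" for j
      using * insert.prems(2)[of j] that by (cases "j = i") auto
  qed
  have "norm (d i *s u) = norm (d i) * norm u"
    by (simp add: norm_vec_def L2_set_def norm_mult power_mult_distrib sum_distrib_left[symmetric] real_sqrt_mult)
  then have "norm ?u' \<le> m * norm u + norm (d i) * norm u"
    using norm_triangle_ineq4[of "u v* complex_matrix M" "d i *s u"] m(1)[of u] by linarith
  also have "\<dots> \<le> 2 * m * norm u" using m(2)[of i] mult_right_mono[OF m(2)[of i], of "norm u"] by simp
  finally have "(norm ?u')\<^sup>2 \<le> (2 * m * norm u)\<^sup>2" by (intro power_mono) auto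
  then have "?K * (norm ?u')\<^sup>2 \<le> ?K * (2 * m * norm u)\<^sup>2" using \<open>?K \<ge> 0\<close> by (intro mult_left_mono) auto
  with IH have "hermitian_form X ?u' \<le> (2 * m)\<^sup>2 * ?K * (norm u)\<^sup>2"
    by (simp add: power_mult_distrib algebra_simps)
  then have "hermitian_form X ?u' / \<delta> \<le> (2 * m)\<^sup>2 * ?K * (norm u)\<^sup>2 / \<delta>"
    using \<delta> by (intro divide_right_mono) auto
  moreover have "\<delta> * hermitian_form X u \<le> hermitian_form Q u + hermitian_form X ?u' / \<delta>"
    using insert.prems(1) by (intro lyapunov_step[OF X lyap \<delta>]) auto
  ultimately have "\<delta> * hermitian_form X u \<le> (\<kappa> + (2 * m)\<^sup>2 * ?K / \<delta>) * (norm u)\<^sup>2"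
    using \<kappa>(2)[of u] by (simp add: algebra_simps)
  then have "hermitian_form X u \<le> (\<kappa> + (2 * m)\<^sup>2 * ?K / \<delta>) * (norm u)\<^sup>2 / \<delta>"
    using \<delta> by (simp add: field_simps)
  then show ?case using insert.hyps by simp
qed


text \<open>In a diagonalizing basis \<open>v\<close> is a multiple of a single column
  \<open>i0\<close> of \<open>P\<close>, so orthogonality to \<open>v\<close> makes coordinate
  \<open>i0\<close> of \<open>u P\<close> vanish. The other \<open>CARD('n) - 1\<close> coordinates
  belong to eigenvalues with real part at least \<open>\<delta>\<close>, and the preceding induction
  applies to them.\<close>

lemma noncritical_variance_bound:
  fixes M X Q :: "real^'n^'n" and u v :: "real^'n"
  assumes X: "pos_semidef X" and lyap: "M ** X + X ** transpose M = Q" and \<delta>: "\<delta> > 0"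
    and diag: "diagonalizable (complex_matrix M)"
    and simple: "is_simple_eigenvalue (complex_matrix M) (complex_of_real lam)"
    and gap: "\<And>\<mu>. is_eigenvalue (complex_matrix M) \<mu> \<Longrightarrow> \<mu> \<noteq> complex_of_real lam \<Longrightarrow> Re \<mu> \<ge> \<delta>"
    and v: "M *v v = lam *\<^sub>R v" "v \<noteq> 0"
    and m: "\<And>u. norm (u v* complex_matrix M) \<le> m * norm u"
      "\<And>u. norm (complex_matrix M *v u) \<le> m * norm u"
    and \<kappa>: "0 \<le> \<kappa>" "\<And>u. hermitian_form Q u \<le> \<kappa> * (norm u)\<^sup>2"
    and orth: "u \<bullet> v = 0"
  shows "u \<bullet> (X *v u) \<le> ((\<lambda>K. (\<kappa> + (2 * m)\<^sup>2 * K / \<delta>) / \<delta>) ^^ (CARD('n) - 1)) 0 * (norm u)\<^sup>2"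
proof -
  let ?M = "complex_matrix M" and ?c = "\<lambda>u::real^'n. \<chi> i. complex_of_real (u $ i)"
  obtain P D :: "complex^'n^'n" where P: "invertible P" and D: "\<And>i j. i \<noteq> j \<Longrightarrow> D $ i $ j = 0"
    and M: "?M = P ** D ** matrix_inv P"
    using diag unfolding diagonalizable_def by metis
  note inv = matrix_inv_inverse[OF P]
  define d where "d i = D $ i $ i" for i
  have MP: "?M ** P = P ** D"
    unfolding M by (metis inv(2) matrix_mul_assoc matrix_mul_rid)
  have Dv: "(D *v c) $ i = d i * c $ i" for c i
  proof -
    have "(D *v c) $ i = (\<Sum>j\<in>{i}. D $ i $ j * c $ j)"
      unfolding matrix_vector_mult_def vec_lambda_beta by (rule sum.mono_neutral_right) (auto simp: D)
    then show ?thesis by (simp add: d_def)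
  qed
  have vD: "(c v* D) $ i = d i * c $ i" for c i
  proof -
    have "(c v* D) $ i = (\<Sum>j\<in>{i}. c $ j * D $ j $ i)"
      unfolding vector_matrix_mult_def vec_lambda_beta by (rule sum.mono_neutral_right) (auto simp: D)
    then show ?thesis by (simp add: d_def mult.commute)
  qed
  have coord: "((u v* ?M) v* P) $ i = d i * (u v* P) $ i" for u i
  proof -
    have "(u v* ?M) v* P = (u v* P) v* D" by (simp only: vector_matrix_mul_assoc MP)
    then show ?thesis by (simp only: vD)
  qed
  have inj: "u = 0" if "u v* P = 0" for u :: "complex^'n"
  proof -
    have "u = (u v* P) v* matrix_inv P"
      by (simp add: vector_matrix_mul_assoc inv)
    then show ?thesis by (simp add: that)
  qed
  have eig: "?M *v column i P = d i *s column i P" for i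
  proof -
    have "(P ** D) $ j $ i = (\<Sum>k\<in>{i}. P $ j $ k * D $ k $ i)" for j
      unfolding matrix_matrix_mult_def vec_lambda_beta by (rule sum.mono_neutral_right) (auto simp: D)
    then have "column i (P ** D) = d i *s column i P"
      by (simp add: vec_eq_iff column_def d_def mult.commute)
    moreover have "?M *v column i P = column i (?M ** P)"
      by (simp add: vec_eq_iff column_def matrix_matrix_mult_def matrix_vector_mult_def)
    ultimately show ?thesis by (simp add: MP)
  qed
  have col: "column i P \<noteq> 0" for i
  proof
    assume "column i P = 0"
    then have "(matrix_inv P ** P) $ i $ i = 0"
      by (simp add: matrix_matrix_mult_def column_def vec_eq_iff)
    then show False by (simp add: inv mat_def)
  qed
  have d_le: "norm (d i) \<le> m" for i
  proof -
    have "norm (d i *s column i P) = norm (d i) * norm (column i P)"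
      by (simp add: norm_vec_def L2_set_def norm_mult power_mult_distrib sum_distrib_left[symmetric] real_sqrt_mult)
    then have "norm (d i) * norm (column i P) \<le> m * norm (column i P)"
      using m(2)[of "column i P"] by (simp add: eig)
    then show ?thesis using col[of i] by simp
  qed
  \<comment> \<open>These are the coefficients of \<open>v\<close> in the columns of
    \<open>P\<close>. The eigenvector equation becomes \<open>D c = lam c\<close>, so a nonzero
    coefficient forces the diagonal entry at that index to be \<open>lam\<close>.\<close>
  define c where "c = matrix_inv P *v ?c v"
  have Pc: "P *v c = ?c v"
    by (simp add: c_def matrix_vector_mul_assoc inv)
  have "?M *v ?c v = complex_of_real lam *s ?c v"
    using v(1) by (simp add: vec_eq_iff matrix_vector_mult_def complex_matrix_def flip: of_real_mult of_real_sum)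
  then have "matrix_inv P *v (?M *v (P *v c)) = complex_of_real lam *s c"
    unfolding Pc by (simp add: c_def vector_scalar_commute)
  moreover have "matrix_inv P *v (?M *v (P *v c)) = D *v c"
    unfolding matrix_vector_mul_assoc MP by (simp add: matrix_mul_assoc inv)
  ultimately have "D *v c = complex_of_real lam *s c" by simp
  then have dc: "d i * c $ i = complex_of_real lam * c $ i" for i
    by (metis Dv vector_smult_component)
  have "c \<noteq> 0"
  proof
    assume "c = 0"
    then have "?c v = 0" using Pc by simp
    then show False using v(2) by (simp add: vec_eq_iff)
  qed
  then obtain i0 where i0: "c $ i0 \<noteq> 0" by (auto simp: vec_eq_iff)
  then have di0: "d i0 = complex_of_real lam" using dc[of i0] by simp
  have uniq: "d i \<noteq> complex_of_real lam" if "i \<noteq> i0" for i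
    using simple_eigenvalue_index_unique[OF P D simple[unfolded M], of i i0] di0 that by (auto simp: d_def)
  have "c $ i = 0" if "i \<noteq> i0" for i
    using dc[of i] uniq[OF that] by simp
  then have col0: "P $ j $ i0 * c $ i0 = complex_of_real (v $ j)" for j
  proof -
    have "(P *v c) $ j = (\<Sum>i\<in>{i0}. P $ j $ i * c $ i)"
      unfolding matrix_vector_mult_def vec_lambda_beta by (rule sum.mono_neutral_right) (use \<open>\<And>i. i \<noteq> i0 \<Longrightarrow> c $ i = 0\<close> in force)+
    then show ?thesis by (simp add: Pc)
  qed
  \<comment> \<open>Multiplying by the nonzero \<open>c $ i0\<close> turns column \<open>i0\<close>
    into \<open>v\<close>, so that the coordinate becomes a multiple of the inner product of
    \<open>u\<close> and \<open>v\<close>.\<close>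
  have "(?c u v* P) $ i0 * c $ i0 = (\<Sum>j\<in>UNIV. complex_of_real (u $ j) * (P $ j $ i0 * c $ i0))"
    by (simp add: vector_matrix_mult_def sum_distrib_right sum_distrib_left mult_ac)
  also have "\<dots> = complex_of_real (u \<bullet> v)"
    by (simp add: col0 inner_vec_def)
  finally have "(?c u v* P) $ i0 = 0" using i0 orth by simp
  then have "hermitian_form X (?c u) \<le>
      ((\<lambda>K. (\<kappa> + (2 * m)\<^sup>2 * K / \<delta>) / \<delta>) ^^ card (UNIV - {i0})) 0 * (norm (?c u))\<^sup>2"
  proof (intro noncritical_variance_bound_coordinates[OF X lyap \<delta> inj coord m(1) d_le \<kappa>])
    show "\<delta> \<le> Re (d i)" if "i \<in> UNIV - {i0}" for i
      using gap[of "d i"] eig[of i] col[of i] uniq[of i] that by (auto simp: is_eigenvalue_def)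
  qed auto
  moreover have "Re_vec (?c u) = u" "Im_vec (?c u) = 0"
    by (simp_all add: Re_vec_def Im_vec_def vec_eq_iff)
  ultimately show ?thesis
    using norm_complex_vec[of "?c u"] by (simp add: hermitian_form_def)
qed

subsection \<open>Gaussian tails and the coefficient of variation\<close>

lemma prob_space_gaussian: "s \<ge> 0 \<Longrightarrow> prob_space (gaussian \<mu> s)"
  by (auto simp: gaussian_def prob_space_return intro!: prob_space_normal_density)

lemma sets_gaussian [simp, measurable_cong]: "sets (gaussian \<mu> s) = sets borel"
  and space_gaussian [simp]: "space (gaussian \<mu> s) = UNIV"
  by (simp_all add: gaussian_def)

text \<open>Chebyshev's inequality for positive \<open>s\<close>. The point mass at
  \<open>s = 0\<close> is treated separately, since a singular covariance can produce degenerate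
  linear functionals.\<close>

lemma gaussian_tail_le:
  assumes "s \<ge> 0" "a > 0"
  shows "measure (gaussian 0 s) {x. a \<le> \<bar>x\<bar>} \<le> s\<^sup>2 / a\<^sup>2"
proof (cases "s = 0")
  case True
  then show ?thesis
    using assms by (simp add: gaussian_def measure_return)
next
  case False
  with assms have s: "s > 0" by simp
  interpret prob_space "gaussian 0 s" using assms by (intro prob_space_gaussian)
  have "distributed (gaussian 0 s) lborel (\<lambda>x. x) (normal_density 0 s)"
    using s by (simp add: distributed_def gaussian_def distr_id2)
  note E = normal_distributed_expectation[OF s this] and V = normal_distributed_variance[OF s this]
  have "integrable (gaussian 0 s) (\<lambda>x. x\<^sup>2)"
    using s integrable_normal_moment[of s 0 2] by (simp add: gaussian_def integrable_density)
  then show ?thesis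
    using Chebyshev_inequality[of "\<lambda>x. x" a] assms(2) by (simp add: E V[simplified E, simplified])
qed

text \<open>The density is at most \<open>1 / (2 * s)\<close> because
  \<open>sqrt (2 * pi) \<ge> 2\<close>, and the interval has length \<open>2 * t * s\<close>. This
  keeps the critical projection, which serves as the scale of \<open>y\<close>, from being small
  relative to its standard deviation.\<close>

lemma gaussian_anticoncentration:
  assumes "s > 0" "t \<ge> 0"
  shows "measure (gaussian 0 s) {x. \<bar>x\<bar> \<le> t * s} \<le> t"
proof -
  have dens: "normal_density 0 s x \<le> 1 / (2 * s)" for x
  proof -
    have "2 \<le> sqrt (2 * pi)" using pi_gt3 by (intro real_le_rsqrt) simp
    then have "2 * s \<le> sqrt (2 * pi) * s" using assms(1) by simp
    then have "normal_density 0 s x \<le> 1 / (2 * s) * 1"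
      unfolding normal_density_def using assms(1)
      by (intro mult_mono) (auto simp: real_sqrt_mult frac_le)
    then show ?thesis by simp
  qed
  have "emeasure (gaussian 0 s) {-(t * s)..t * s} = (\<integral>\<^sup>+x. ennreal (normal_density 0 s x) * indicator {-(t * s)..t * s} x \<partial>lborel)"
    using assms by (simp add: gaussian_def emeasure_density)
  also have "\<dots> \<le> (\<integral>\<^sup>+x. ennreal (1 / (2 * s)) * indicator {-(t * s)..t * s} x \<partial>lborel)"
    by (intro nn_integral_mono mult_right_mono ennreal_leI dens) auto
  also have "\<dots> = ennreal (1 / (2 * s)) * ennreal (2 * t * s)"
    using assms by (simp add: nn_integral_cmult_indicator mult_ac)
  also have "\<dots> = ennreal t"
    using assms by (simp flip: ennreal_mult)
  finally have "measure (gaussian 0 s) {-(t * s)..t * s} \<le> t"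
    using assms by (simp add: measure_def enn2real_leI)
  moreover have "{x. \<bar>x\<bar> \<le> t * s} = {-(t * s)..t * s}" by auto
  ultimately show ?thesis by simp
qed

section \<open>Gaussian vectors through their linear functionals\<close>

lemma multivariate_normal_marginal:
  assumes "multivariate_normal P Z 0 C" "S \<in> sets borel"
  shows "measure P {\<omega> \<in> space P. u \<bullet> Z \<omega> \<in> S} = measure (gaussian 0 (sqrt (u \<bullet> (C *v u)))) S"
proof -
  have [measurable]: "Z \<in> borel_measurable P" using assms(1) by (simp add: multivariate_normal_def)
  have "distr P borel (\<lambda>\<omega>. u \<bullet> Z \<omega>) = gaussian 0 (sqrt (u \<bullet> (C *v u)))"
    using assms(1) unfolding multivariate_normal_def by (metis inner_zero_right)
  then show ?thesis
    using assms(2) by (subst \<open>_ = gaussian _ _\<close>[symmetric], subst measure_distr)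
      (auto intro!: arg_cong[where f = "measure P"])
qed

lemma multivariate_normal_tail:
  assumes "multivariate_normal P Z 0 C" "a > 0"
  shows "measure P {\<omega> \<in> space P. a \<le> \<bar>u \<bullet> Z \<omega>\<bar>} \<le> (u \<bullet> (C *v u)) / a\<^sup>2"
proof -
  have "0 \<le> u \<bullet> (C *v u)" using assms(1) by (simp add: multivariate_normal_def pos_semidef_def)
  moreover have "{x::real. a \<le> \<bar>x\<bar>} \<in> sets borel" by measurable
  ultimately show ?thesis
    using multivariate_normal_marginal[OF assms(1), of "{x. a \<le> \<bar>x\<bar>}" u] gaussian_tail_le[of "sqrt (u \<bullet> (C *v u))" a] assms(2)
    by simp
qed

lemma multivariate_normal_anticoncentration:
  assumes "multivariate_normal P Z 0 C" "u \<bullet> (C *v u) > 0" "t \<ge> 0"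
  shows "measure P {\<omega> \<in> space P. \<bar>u \<bullet> Z \<omega>\<bar> \<le> t * sqrt (u \<bullet> (C *v u))} \<le> t"
proof -
  have "{x::real. \<bar>x\<bar> \<le> t * sqrt (u \<bullet> (C *v u))} \<in> sets borel" by measurable
  then show ?thesis
    using multivariate_normal_marginal[OF assms(1), of "{x. \<bar>x\<bar> \<le> t * sqrt (u \<bullet> (C *v u))}" u]
      gaussian_anticoncentration[of "sqrt (u \<bullet> (C *v u))" t] assms(2,3)
    by simp
qed

lemma norm_ge_imp_component_ge:
  fixes x :: "real^'n"
  assumes "real CARD('n) * a \<le> norm x"
  obtains i where "a \<le> \<bar>x $ i\<bar>"
proof (rule ccontr)
  assume "\<not> thesis"
  with that have "\<bar>x $ i\<bar> < a" for i using not_le by blast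
  then have "(\<Sum>i\<in>UNIV. \<bar>x $ i\<bar>) < (\<Sum>i\<in>(UNIV::'n set). a)" by (intro sum_strict_mono) auto
  then show False using assms norm_le_l1_cart[of x] by simp
qed

text \<open>If the norm reaches \<open>a\<close>, some component of \<open>T\<close> reaches
  \<open>a / CARD('k)\<close>. A union bound over the components gives one factor
  \<open>CARD('k)\<close>, and squaring the reduced threshold gives the other two. The map
  \<open>T\<close> lets the same bound serve for a projected vector and for the vector
  itself.\<close>

lemma multivariate_normal_norm_tail:
  fixes Z :: "'a \<Rightarrow> real^'n" and T :: "real^'n \<Rightarrow> real^'k"
  assumes P: "prob_space P" and Z: "multivariate_normal P Z 0 C" and a: "a > 0"
    and T: "\<And>x i. T x $ i = u i \<bullet> x" and K: "\<And>i. u i \<bullet> (C *v u i) \<le> K"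
  shows "measure P {\<omega> \<in> space P. a \<le> norm (T (Z \<omega>))} \<le> real CARD('k) ^ 3 * K / a\<^sup>2"
proof -
  interpret prob_space P by fact
  have [measurable]: "Z \<in> borel_measurable P" using Z by (simp add: multivariate_normal_def)
  let ?n = "real CARD('k)"
  let ?E = "\<lambda>i. {\<omega> \<in> space P. a / ?n \<le> \<bar>u i \<bullet> Z \<omega>\<bar>}"
  have "{\<omega> \<in> space P. a \<le> norm (T (Z \<omega>))} \<subseteq> (\<Union>i. ?E i)"
  proof safe
    fix \<omega> assume "\<omega> \<in> space P" "a \<le> norm (T (Z \<omega>))"
    moreover obtain i where "a / ?n \<le> \<bar>T (Z \<omega>) $ i\<bar>"
      using norm_ge_imp_component_ge[of "a / ?n" "T (Z \<omega>)"] \<open>a \<le> norm (T (Z \<omega>))\<close> by auto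
    ultimately show "\<omega> \<in> (\<Union>i. ?E i)" by (auto simp: T)
  qed
  then have "prob {\<omega> \<in> space P. a \<le> norm (T (Z \<omega>))} \<le> prob (\<Union>i. ?E i)"
    by (intro finite_measure_mono) auto
  also have "\<dots> \<le> (\<Sum>i\<in>UNIV. prob (?E i))"
    by (intro finite_measure_subadditive_finite) auto
  also have "\<dots> \<le> (\<Sum>i\<in>(UNIV :: 'k set). K / (a / ?n)\<^sup>2)"
  proof (intro sum_mono)
    fix i
    have "prob (?E i) \<le> (u i \<bullet> (C *v u i)) / (a / ?n)\<^sup>2"
      using a by (intro multivariate_normal_tail[OF Z]) simp
    also have "\<dots> \<le> K / (a / ?n)\<^sup>2" by (intro divide_right_mono K) simp
    finally show "prob (?E i) \<le> K / (a / ?n)\<^sup>2" .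
  qed
  finally show ?thesis by (simp add: power2_eq_square power3_eq_cube field_simps)
qed

section \<open>Scale invariance and continuity of the coefficient of variation\<close>

lemma avg_scaleR: "avg (c *\<^sub>R u) = c * avg u"
  by (simp add: avg_def sum_distrib_left)

lemma sample_var_scaleR: "sample_var (c *\<^sub>R u) = c\<^sup>2 * sample_var u"
  by (simp add: sample_var_def avg_scaleR sum_distrib_left power_mult_distrib flip: right_diff_distrib)

lemma coeff_var_scaleR: "c \<noteq> 0 \<Longrightarrow> coeff_var (c *\<^sub>R u) = coeff_var u"
  by (simp add: coeff_var_def avg_scaleR sample_var_scaleR real_sqrt_mult abs_mult)

text \<open>On unit vectors the sample variance thereby depends on the mean alone, which is how
  \<open>\<rho>c\<close> determines the limit.\<close>

lemma sample_var_eq: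
  fixes u :: "real^'n"
  shows "sample_var u = ((norm u)\<^sup>2 - real CARD('n) * (avg u)\<^sup>2) / (real CARD('n) - 1)"
proof -
  have "(\<Sum>i\<in>UNIV. (u $ i - avg u)\<^sup>2) = (\<Sum>i\<in>UNIV. (u $ i)\<^sup>2) - 2 * avg u * (\<Sum>i\<in>UNIV. u $ i) + real CARD('n) * (avg u)\<^sup>2"
    by (simp add: power2_diff sum.distrib sum_subtractf sum_distrib_left sum_distrib_right mult_ac)
  moreover have "(\<Sum>i\<in>UNIV. u $ i) = real CARD('n) * avg u" by (simp add: avg_def)
  ultimately show ?thesis
    by (simp add: sample_var_def norm_vec_def L2_set_def sum_nonneg power2_eq_square)
qed

lemma continuous_on_avg [continuous_intros]: "continuous_on UNIV avg"
  unfolding avg_def by (intro continuous_intros) auto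

lemma continuous_on_sample_var [continuous_intros]: "continuous_on UNIV sample_var"
  unfolding sample_var_def divide_inverse by (intro continuous_intros continuous_on_avg)

lemmas isCont_avg = continuous_on_interior[OF continuous_on_avg, simplified]
  and isCont_sample_var = continuous_on_interior[OF continuous_on_sample_var, simplified]

lemma isCont_coeff_var: "avg u \<noteq> 0 \<Longrightarrow> isCont coeff_var u"
  unfolding coeff_var_def by (intro continuous_intros isCont_avg isCont_sample_var) auto

lemma borel_measurable_avg [measurable]: "avg \<in> borel_measurable borel"
  by (intro borel_measurable_continuous_onI continuous_on_avg)

lemma borel_measurable_coeff_var [measurable]: "coeff_var \<in> borel_measurable borel"
proof -
  have [measurable]: "sample_var \<in> borel_measurable borel"
    by (intro borel_measurable_continuous_onI continuous_on_sample_var)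
  show ?thesis unfolding coeff_var_def[abs_def] by measurable
qed

subsection \<open>Behaviour near the critical parameter\<close>

lemma norm_vec_le_card_mult:
  fixes x :: "('a::real_normed_vector)^'n"
  assumes "\<And>i. norm (x $ i) \<le> c"
  shows "norm x \<le> real CARD('n) * c"
proof -
  have "norm x \<le> (\<Sum>i\<in>UNIV. norm (x $ i))"
    unfolding norm_vec_def by (rule L2_set_le_sum) simp
  also have "\<dots> \<le> (\<Sum>i\<in>(UNIV::'n set). c)" by (intro sum_mono assms)
  finally show ?thesis by simp
qed

lemma norm_complex_matrix_mult_le:
  fixes A :: "real^'n^'n" and u :: "complex^'n"
  assumes "\<And>i j. \<bar>A $ i $ j\<bar> \<le> k"
  shows "norm (complex_matrix A *v u) \<le> (real CARD('n) * (real CARD('n) * k)) * norm u"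
    and "norm (u v* complex_matrix A) \<le> (real CARD('n) * (real CARD('n) * k)) * norm u"
proof -
  have *: "norm (complex_of_real (A $ i $ j) * u $ l) \<le> k * norm u" for i j l
    unfolding norm_mult using assms[of i j] Finite_Cartesian_Product.norm_nth_le[of u l]
    by (intro mult_mono) (auto intro: order_trans[OF abs_ge_zero])
  have "norm (complex_matrix A *v u) \<le> real CARD('n) * (real CARD('n) * (k * norm u))"
  proof (rule norm_vec_le_card_mult)
    fix i
    have "norm ((complex_matrix A *v u) $ i) \<le> (\<Sum>j\<in>(UNIV::'n set). k * norm u)"
      unfolding matrix_vector_mult_def complex_matrix_def vec_lambda_beta nth_map_matrix
      by (intro sum_norm_le *)
    then show "norm ((complex_matrix A *v u) $ i) \<le> real CARD('n) * (k * norm u)" by simp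
  qed
  then show "norm (complex_matrix A *v u) \<le> (real CARD('n) * (real CARD('n) * k)) * norm u"
    by (simp add: mult.assoc)
  have "norm (u v* complex_matrix A) \<le> real CARD('n) * (real CARD('n) * (k * norm u))"
  proof (rule norm_vec_le_card_mult)
    fix i
    have "norm ((u v* complex_matrix A) $ i) \<le> (\<Sum>j\<in>(UNIV::'n set). k * norm u)"
      unfolding vector_matrix_mult_def complex_matrix_def vec_lambda_beta nth_map_matrix
      by (rule sum_norm_le, subst mult.commute, rule *)
    then show "norm ((u v* complex_matrix A) $ i) \<le> real CARD('n) * (k * norm u)" by simp
  qed
  then show "norm (u v* complex_matrix A) \<le> (real CARD('n) * (real CARD('n) * k)) * norm u"
    by (simp add: mult.assoc)
qed

lemma matrix_quadratic_bound:
  fixes Q :: "real^'n^'n"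
  obtains \<kappa> where "\<kappa> \<ge> 0" "\<And>a. a \<bullet> (Q *v a) \<le> \<kappa> * (norm a)\<^sup>2" "\<And>u. hermitian_form Q u \<le> \<kappa> * (norm u)\<^sup>2"
proof -
  obtain \<kappa> where \<kappa>: "\<kappa> > 0" "\<And>a. norm (Q *v a) \<le> norm a * \<kappa>"
    using bounded_linear.pos_bounded[OF matrix_vector_mul_bounded_linear[of Q]] by blast
  have *: "a \<bullet> (Q *v a) \<le> \<kappa> * (norm a)\<^sup>2" for a
  proof -
    have "a \<bullet> (Q *v a) \<le> norm a * norm (Q *v a)" by (rule norm_cauchy_schwarz)
    also have "\<dots> \<le> norm a * (norm a * \<kappa>)" by (intro mult_left_mono \<kappa>) simp
    finally show ?thesis by (simp add: power2_eq_square mult_ac)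
  qed
  moreover have "hermitian_form Q u \<le> \<kappa> * (norm u)\<^sup>2" for u
    unfolding hermitian_form_def norm_complex_vec using add_mono[OF * *, of "Re_vec u" "Im_vec u"]
    by (simp add: algebra_simps)
  ultimately show ?thesis using that[of \<kappa>] \<kappa>(1) by simp
qed

text \<open>The total derivative \<open>f'\<close> is itself differentiable at the endpoint of the
  branch, hence continuous there, so its norm along the branch is eventually below its limit plus 1.
  Each entry of the drift matrix is, up to sign, a component of \<open>f'\<close> applied to a unit
  vector \<open>(axis j 1, 0)\<close>.\<close>

lemma drift_matrix_locally_bounded:
  fixes F :: "real^'n \<Rightarrow> real \<Rightarrow> real^'n"
  assumes "C2_on U (\<lambda>(x, \<alpha>). F x \<alpha>)" "(xc, \<alpha>c) \<in> U"
    and lim: "((\<lambda>\<alpha>. (xs \<alpha>, \<alpha>)) \<longlongrightarrow> (xc, \<alpha>c)) G" and "\<forall>\<^sub>F \<alpha> in G. (xs \<alpha>, \<alpha>) \<in> U"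
  shows "\<exists>k. \<forall>\<^sub>F \<alpha> in G. \<forall>i j. \<bar>drift_matrix F xs \<alpha> $ i $ j\<bar> \<le> k"
proof -
  obtain f' f'' where f': "\<And>p. p \<in> U \<Longrightarrow> ((\<lambda>(x, \<alpha>). F x \<alpha>) has_derivative blinfun_apply (f' p)) (at p)"
    and f'': "\<And>p. p \<in> U \<Longrightarrow> (f' has_derivative blinfun_apply (f'' p)) (at p)"
    using assms(1) unfolding C2_on_def by auto
  have "isCont f' (xc, \<alpha>c)" using f''[OF assms(2)] by (rule has_derivative_continuous)
  then have "((\<lambda>\<alpha>. f' (xs \<alpha>, \<alpha>)) \<longlongrightarrow> f' (xc, \<alpha>c)) G"
    using lim by (rule isCont_tendsto_compose)
  then have "((\<lambda>\<alpha>. norm (f' (xs \<alpha>, \<alpha>))) \<longlongrightarrow> norm (f' (xc, \<alpha>c))) G" by (rule tendsto_norm)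
  then have "\<forall>\<^sub>F \<alpha> in G. norm (f' (xs \<alpha>, \<alpha>)) < norm (f' (xc, \<alpha>c)) + 1"
    by (rule order_tendstoD) simp
  then have "\<forall>\<^sub>F \<alpha> in G. \<forall>i j. \<bar>drift_matrix F xs \<alpha> $ i $ j\<bar> \<le> norm (f' (xc, \<alpha>c)) + 1"
    using assms(4)
  proof eventually_elim
    case (elim \<alpha>)
    \<comment> \<open>The Jacobian at frozen \<open>\<alpha>\<close> is obtained from the joint
      derivative by the chain rule along this embedding.\<close>
    have "((\<lambda>x. (x, \<alpha>)) has_derivative (\<lambda>h. (h, 0))) (at (xs \<alpha>))"
      by (auto intro!: derivative_eq_intros)
    from has_derivative_compose[OF this f'[OF elim(2)]]
    have "((\<lambda>x. F x \<alpha>) has_derivative (\<lambda>h. f' (xs \<alpha>, \<alpha>) (h, 0))) (at (xs \<alpha>))" by simp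
    then have J: "jacobian (\<lambda>x. F x \<alpha>) (at (xs \<alpha>)) = matrix (\<lambda>h. f' (xs \<alpha>, \<alpha>) (h, 0))"
      unfolding jacobian_def by (metis frechet_derivative_at)
    show ?case
    proof (intro allI)
      fix i j
      have "\<bar>drift_matrix F xs \<alpha> $ i $ j\<bar> = \<bar>f' (xs \<alpha>, \<alpha>) (axis j 1, 0) $ i\<bar>"
        by (simp add: drift_matrix_def J matrix_def)
      also have "\<dots> \<le> norm (f' (xs \<alpha>, \<alpha>) (axis j 1, 0))" by (rule component_le_norm_cart)
      also have "\<dots> \<le> norm (f' (xs \<alpha>, \<alpha>)) * norm (axis j 1 :: real^'n, 0 :: real)" by (rule norm_blinfun)
      also have "\<dots> = norm (f' (xs \<alpha>, \<alpha>))" by (simp add: norm_Pair)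
      finally show "\<bar>drift_matrix F xs \<alpha> $ i $ j\<bar> \<le> norm (f' (xc, \<alpha>c)) + 1" using elim(1) by simp
    qed
  qed
  then show ?thesis by blast
qed

text \<open>After the critical component is removed from \<open>\<mu> + z - eps\<close>, three
  pieces remain: a bounded mean, the part of \<open>z\<close> seen by functionals orthogonal to
  \<open>v\<close>, and the baseline noise of fixed covariance. All are bounded in probability,
  while the standard deviation of \<open>w \<bullet> z\<close> diverges.\<close>

lemma critical_projection_dominates:
  fixes z eps :: "'i \<Rightarrow> 'a \<Rightarrow> real^'n"
  assumes P: "\<forall>\<^sub>F \<alpha> in G. prob_space (P \<alpha>)"
    and z: "\<forall>\<^sub>F \<alpha> in G. multivariate_normal (P \<alpha>) (z \<alpha>) 0 (C \<alpha>)"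
    and eps: "\<forall>\<^sub>F \<alpha> in G. multivariate_normal (P \<alpha>) (eps \<alpha>) 0 C'"
    and K: "K \<ge> 0" "\<forall>\<^sub>F \<alpha> in G. \<forall>u. u \<bullet> v \<alpha> = 0 \<longrightarrow> u \<bullet> (C \<alpha> *v u) \<le> K * (norm u)\<^sup>2"
    and vw: "\<forall>\<^sub>F \<alpha> in G. norm (v \<alpha>) = 1 \<and> w \<alpha> \<bullet> v \<alpha> = 1 \<and> norm (w \<alpha>) \<le> W"
    and \<mu>: "\<forall>\<^sub>F \<alpha> in G. norm (\<mu> \<alpha>) \<le> R"
    and s: "filterlim (\<lambda>\<alpha>. w \<alpha> \<bullet> (C \<alpha> *v w \<alpha>)) at_top G"
    and \<eta>: "\<eta> > 0"
  shows "((\<lambda>\<alpha>. measure (P \<alpha>) {\<omega> \<in> space (P \<alpha>).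
      \<eta> * \<bar>w \<alpha> \<bullet> z \<alpha> \<omega>\<bar> \<le> norm (\<mu> \<alpha> + z \<alpha> \<omega> - eps \<alpha> \<omega> - (w \<alpha> \<bullet> z \<alpha> \<omega>) *\<^sub>R v \<alpha>)}) \<longlongrightarrow> 0) G"
    (is "((\<lambda>\<alpha>. measure (P \<alpha>) (?bad \<alpha>)) \<longlongrightarrow> 0) G")
proof (rule tendstoI)
  fix e :: real assume e: "e > 0"
  \<comment> \<open>Half of \<open>e\<close> pays for the event that the critical projection is
    below \<open>t\<close> standard deviations, the other half for the two tail events
    together.\<close>
  define t where "t = e / 2"
  have t: "t > 0" using e by (simp add: t_def)
  define \<sigma> where "\<sigma> \<alpha> = sqrt (w \<alpha> \<bullet> (C \<alpha> *v w \<alpha>))" for \<alpha>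
  \<comment> \<open>One third of \<open>\<eta>\<close> times the likely lower bound
    \<open>t * \<sigma> \<alpha>\<close> is allotted to each of the three remaining pieces.\<close>
  define a where "a \<alpha> = \<eta> * t * \<sigma> \<alpha> / 3" for \<alpha>
  obtain \<kappa> where \<kappa>: "\<kappa> \<ge> 0" "\<And>u. u \<bullet> (C' *v u) \<le> \<kappa> * (norm u)\<^sup>2"
    using matrix_quadratic_bound by metis
  \<comment> \<open>The sum of the constants from the two norm tails: \<open>1 + W\<close> bounds
    the functionals extracting the noncritical part of \<open>z\<close>, and \<open>\<kappa>\<close>
    bounds the baseline variances.\<close>
  define B where "B = real CARD('n) ^ 3 * (K * (1 + W)\<^sup>2 + \<kappa>)"
  have \<sigma>: "filterlim \<sigma> at_top G"
    unfolding \<sigma>_def by (rule filterlim_compose[OF sqrt_at_top s])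
  have "filterlim (\<lambda>\<alpha>. (\<eta> * t / 3) * \<sigma> \<alpha>) at_top G"
    using \<eta> t by (intro filterlim_tendsto_pos_mult_at_top[OF tendsto_const _ \<sigma>]) auto
  then have a: "filterlim a at_top G" by (simp add: a_def[abs_def])
  have "filterlim (\<lambda>\<alpha>. (a \<alpha>)\<^sup>2) at_top G" by (intro filterlim_pow_at_top a) simp
  then have "((\<lambda>\<alpha>. B / (a \<alpha>)\<^sup>2) \<longlongrightarrow> 0) G" by (rule real_tendsto_divide_at_top[OF tendsto_const])
  then have "\<forall>\<^sub>F \<alpha> in G. B / (a \<alpha>)\<^sup>2 < t" using t by (rule order_tendstoD)
  \<comment> \<open>This makes the threshold positive and larger than the norm of the mean, whose
    piece therefore needs no exceptional event.\<close>
  moreover have "\<forall>\<^sub>F \<alpha> in G. max R 0 < a \<alpha>" using a by (simp only: filterlim_at_top_dense)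
  moreover have "\<forall>\<^sub>F \<alpha> in G. 0 < w \<alpha> \<bullet> (C \<alpha> *v w \<alpha>)" using s by (simp add: filterlim_at_top_dense)
  ultimately show "\<forall>\<^sub>F \<alpha> in G. dist (measure (P \<alpha>) (?bad \<alpha>)) 0 < e"
    using P z eps K(2) vw \<mu>
  proof eventually_elim
    case (elim \<alpha>)
    interpret prob_space "P \<alpha>" by (rule elim(4))
    note z = elim(5) and eps = elim(6)
    have [measurable]: "z \<alpha> \<in> borel_measurable (P \<alpha>)" "eps \<alpha> \<in> borel_measurable (P \<alpha>)"
      using z eps by (simp_all add: multivariate_normal_def)
    have a_pos: "a \<alpha> > 0" using elim(2) by simp
    define T where "T x = x - (w \<alpha> \<bullet> x) *\<^sub>R v \<alpha>" for x
    \<comment> \<open>Row \<open>i\<close> of the projection \<open>I - v w^T\<close>. It is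
      orthogonal to \<open>v\<close> because \<open>w \<bullet> v = 1\<close>, so the bound
      \<open>K\<close> applies to it.\<close>
    define u where "u i = axis i 1 - v \<alpha> $ i *\<^sub>R w \<alpha>" for i
    let ?E1 = "{\<omega> \<in> space (P \<alpha>). \<bar>w \<alpha> \<bullet> z \<alpha> \<omega>\<bar> \<le> t * \<sigma> \<alpha>}"
    let ?E2 = "{\<omega> \<in> space (P \<alpha>). a \<alpha> \<le> norm (T (z \<alpha> \<omega>))}"
    let ?E3 = "{\<omega> \<in> space (P \<alpha>). a \<alpha> \<le> norm (eps \<alpha> \<omega>)}"
    have "?bad \<alpha> \<subseteq> ?E1 \<union> (?E2 \<union> ?E3)"
    proof (rule subsetI, rule ccontr)
      fix \<omega> assume \<omega>: "\<omega> \<in> ?bad \<alpha>" and "\<omega> \<notin> ?E1 \<union> (?E2 \<union> ?E3)"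
      then have 1: "t * \<sigma> \<alpha> < \<bar>w \<alpha> \<bullet> z \<alpha> \<omega>\<bar>" "norm (T (z \<alpha> \<omega>)) < a \<alpha>" "norm (eps \<alpha> \<omega>) < a \<alpha>" by auto
      have "norm (\<mu> \<alpha> + z \<alpha> \<omega> - eps \<alpha> \<omega> - (w \<alpha> \<bullet> z \<alpha> \<omega>) *\<^sub>R v \<alpha>) = norm (\<mu> \<alpha> + T (z \<alpha> \<omega>) - eps \<alpha> \<omega>)"
        by (simp add: T_def algebra_simps)
      also have "\<dots> \<le> norm (\<mu> \<alpha>) + norm (T (z \<alpha> \<omega>)) + norm (eps \<alpha> \<omega>)"
        by (meson norm_triangle_ineq4 norm_triangle_ineq add_right_mono order_trans)
      also have "\<dots> < 3 * a \<alpha>" using 1 elim(2,9) by linarith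
      also have "\<dots> = \<eta> * (t * \<sigma> \<alpha>)" by (simp add: a_def)
      also have "\<dots> \<le> \<eta> * \<bar>w \<alpha> \<bullet> z \<alpha> \<omega>\<bar>" using \<eta> 1 by (intro mult_left_mono) auto
      finally show False using \<omega> by simp
    qed
    then have "prob (?bad \<alpha>) \<le> prob (?E1 \<union> (?E2 \<union> ?E3))"
      unfolding T_def by (intro finite_measure_mono) measurable
    also have "\<dots> \<le> prob ?E1 + prob (?E2 \<union> ?E3)"
      unfolding T_def by (rule measure_Un_le) measurable
    also have "prob (?E2 \<union> ?E3) \<le> prob ?E2 + prob ?E3"
      unfolding T_def by (rule measure_Un_le) measurable
    also have "prob ?E1 \<le> t"
      unfolding \<sigma>_def using t by (intro multivariate_normal_anticoncentration[OF z elim(3)]) simp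
    also have "prob ?E2 \<le> real CARD('n) ^ 3 * (K * (1 + W)\<^sup>2) / (a \<alpha>)\<^sup>2"
    proof (rule multivariate_normal_norm_tail[OF elim(4) z a_pos, where u = u])
      show "T x $ i = u i \<bullet> x" for x i
        by (simp add: T_def u_def inner_diff_left inner_axis' mult.commute)
      fix i
      have "u i \<bullet> v \<alpha> = 0" using elim(8) by (simp add: u_def inner_diff_left inner_axis')
      then have "u i \<bullet> (C \<alpha> *v u i) \<le> K * (norm (u i))\<^sup>2" using elim(7) by blast
      also have "\<dots> \<le> K * (1 + W)\<^sup>2"
      proof (intro mult_left_mono power_mono K norm_ge_zero)
        have "norm (u i) \<le> 1 + norm (v \<alpha> $ i *\<^sub>R w \<alpha>)"
          unfolding u_def using norm_triangle_ineq4[of "axis i 1" "v \<alpha> $ i *\<^sub>R w \<alpha>"] by simp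
        also have "norm (v \<alpha> $ i *\<^sub>R w \<alpha>) \<le> 1 * W"
          unfolding norm_scaleR using elim(8) component_le_norm_cart[of "v \<alpha>" i] by (intro mult_mono) auto
        finally show "norm (u i) \<le> 1 + W" by simp
      qed
      finally show "u i \<bullet> (C \<alpha> *v u i) \<le> K * (1 + W)\<^sup>2" .
    qed
    also have "prob ?E3 \<le> real CARD('n) ^ 3 * \<kappa> / (a \<alpha>)\<^sup>2"
    proof (rule multivariate_normal_norm_tail[OF elim(4) eps a_pos, where T = "\<lambda>x. x" and u = "\<lambda>i. axis i 1"])
      show "axis i 1 \<bullet> (C' *v axis i 1) \<le> \<kappa>" for i
        using \<kappa>(2)[of "axis i 1"] by simp
    qed (simp add: inner_axis')
    finally have "prob (?bad \<alpha>) \<le> t + B / (a \<alpha>)\<^sup>2"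
      by (simp add: B_def add_divide_distrib algebra_simps)
    then have "prob (?bad \<alpha>) < e" using elim(1) unfolding t_def by linarith
    then show ?case by simp
  qed
qed

section \<open>Limits of the coefficient of variation in the three cases\<close>

theorem corollary7p2:
  fixes F :: "real^'n \<Rightarrow> real \<Rightarrow> real^'n"
    and B :: "real^'m^'n"
    and A :: "real set"
    and \<alpha>c \<alpha>0 \<delta> :: real
    and xs :: "real \<Rightarrow> real^'n" and xc :: "real^'n"
    and U :: "((real^'n) \<times> real) set"
    and M C :: "real \<Rightarrow> real^'n^'n"
    and lam :: "real \<Rightarrow> real"
    and v w :: "real \<Rightarrow> real^'n" and vc wc :: "real^'n"
    and \<rho>c :: real
    and P :: "real \<Rightarrow> 'a measure"
    and z eps x b y :: "real \<Rightarrow> 'a \<Rightarrow> real^'n"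
    and l :: nat
  assumes N: "CARD('n) \<ge> 2"
    \<comment> \<open>parameter range\<close>
    and A: "is_interval A" "A \<subseteq> {..<\<alpha>c}" "\<forall>\<^sub>F \<alpha> in at_left \<alpha>c. \<alpha> \<in> A" "\<alpha>0 \<in> A"
    \<comment> \<open>equilibrium branch\<close>
    and smooth: "open U" "\<forall>\<alpha>\<in>A. (xs \<alpha>, \<alpha>) \<in> U" "(xc, \<alpha>c) \<in> U" "C2_on U (\<lambda>(x, \<alpha>). F x \<alpha>)"
    and equilibrium: "\<forall>\<alpha>\<in>A. F (xs \<alpha>) \<alpha> = 0"
    and stable: "\<forall>\<alpha>\<in>A. asymptotically_stable (\<lambda>x. F x \<alpha>) (xs \<alpha>)"
    and M: "\<And>\<alpha>. M \<alpha> = drift_matrix F xs \<alpha>"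
    and C: "\<forall>\<alpha>\<in>A. stationary_covariance (M \<alpha>) B (C \<alpha>)"
    \<comment> \<open>regular simple real critical eigenvalue\<close>
    and xc: "(xs \<longlongrightarrow> xc) (at_left \<alpha>c)"
    and diag: "\<forall>\<^sub>F \<alpha> in at_left \<alpha>c. diagonalizable (complex_matrix (M \<alpha>))"
    and pos: "\<forall>\<^sub>F \<alpha> in at_left \<alpha>c. \<forall>\<mu>. is_eigenvalue (complex_matrix (M \<alpha>)) \<mu> \<longrightarrow> Re \<mu> > 0"
    and simple: "\<forall>\<^sub>F \<alpha> in at_left \<alpha>c.
          is_simple_eigenvalue (complex_matrix (M \<alpha>)) (complex_of_real (lam \<alpha>))"
    and smallest: "\<forall>\<^sub>F \<alpha> in at_left \<alpha>c.
          \<forall>\<mu>. is_eigenvalue (complex_matrix (M \<alpha>)) \<mu> \<longrightarrow> lam \<alpha> \<le> Re \<mu>"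
    and lam_pos: "\<forall>\<^sub>F \<alpha> in at_left \<alpha>c. lam \<alpha> > 0"
    and lam_lim: "(lam \<longlongrightarrow> 0) (at_left \<alpha>c)"
    and gap: "\<delta> > 0" "\<forall>\<^sub>F \<alpha> in at_left \<alpha>c. \<forall>\<mu>. is_eigenvalue (complex_matrix (M \<alpha>)) \<mu> \<longrightarrow>
          \<mu> \<noteq> complex_of_real (lam \<alpha>) \<longrightarrow> Re \<mu> \<ge> \<delta>"
    and eigenvectors: "\<forall>\<^sub>F \<alpha> in at_left \<alpha>c.
          M \<alpha> *v v \<alpha> = lam \<alpha> *\<^sub>R v \<alpha> \<and> w \<alpha> v* M \<alpha> = lam \<alpha> *\<^sub>R w \<alpha> \<and>
          norm (v \<alpha>) = 1 \<and> w \<alpha> \<bullet> v \<alpha> = 1"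
    and vc: "(v \<longlongrightarrow> vc) (at_left \<alpha>c)"
    and wc: "(w \<longlongrightarrow> wc) (at_left \<alpha>c)"
    \<comment> \<open>snapshot and baseline\<close>
    and P: "\<forall>\<alpha>\<in>A. prob_space (P \<alpha>)"
    and z: "\<forall>\<alpha>\<in>A. multivariate_normal (P \<alpha>) (z \<alpha>) 0 (C \<alpha>)"
    and l: "l \<ge> 1"
    and eps: "\<forall>\<alpha>\<in>A. multivariate_normal (P \<alpha>) (eps \<alpha>) 0 ((1 / real l) *\<^sub>R C \<alpha>0)"
    and indep: "\<forall>\<alpha>\<in>A. prob_space.indep_var (P \<alpha>) borel (z \<alpha>) borel (eps \<alpha>)"
    and x: "\<And>\<alpha> \<omega>. x \<alpha> \<omega> = xs \<alpha> + z \<alpha> \<omega>"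
    and b: "\<And>\<alpha> \<omega>. b \<alpha> \<omega> = xs \<alpha>0 + eps \<alpha> \<omega>"
    and y: "\<And>\<alpha> \<omega>. y \<alpha> \<omega> = x \<alpha> \<omega> - b \<alpha> \<omega>"
    and sigma_eff: "wc \<bullet> ((B ** transpose B) *v wc) > 0"
    and x_nonzero: "\<forall>\<^sub>F \<alpha> in at_left \<alpha>c. measure (P \<alpha>) {\<omega> \<in> space (P \<alpha>). avg (x \<alpha> \<omega>) = 0} = 0"
    and y_nonzero: "\<forall>\<^sub>F \<alpha> in at_left \<alpha>c. measure (P \<alpha>) {\<omega> \<in> space (P \<alpha>). avg (y \<alpha> \<omega>) = 0} = 0"
    and rho: "\<rho>c = (\<Sum>i\<in>UNIV. vc $ i)\<^sup>2 / real CARD('n)"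
  shows
    "(0 < \<rho>c \<and> \<rho>c < 1 \<longrightarrow>
        tendsto_in_prob P (\<lambda>\<alpha> \<omega>. coeff_var (y \<alpha> \<omega>))
          (sqrt (real CARD('n) * (1 - \<rho>c) / ((real CARD('n) - 1) * \<rho>c))) (at_left \<alpha>c)) \<and>
     (\<rho>c = 1 \<longrightarrow> tendsto_in_prob P (\<lambda>\<alpha> \<omega>. coeff_var (y \<alpha> \<omega>)) 0 (at_left \<alpha>c)) \<and>
     (\<rho>c = 0 \<longrightarrow> tendsto_infinity_in_prob P (\<lambda>\<alpha> \<omega>. coeff_var (y \<alpha> \<omega>)) (at_left \<alpha>c))"
proof -
  let ?G = "at_left \<alpha>c" and ?n = "real CARD('n)"
  define Q where "Q = B ** transpose B"
  define \<mu> where "\<mu> \<alpha> = xs \<alpha> - xs \<alpha>0" for \<alpha>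
  have y_eq: "y \<alpha> \<omega> = \<mu> \<alpha> + z \<alpha> \<omega> - eps \<alpha> \<omega>" for \<alpha> \<omega>
    by (simp add: y x b \<mu>_def)
  have lyap: "\<forall>\<^sub>F \<alpha> in ?G. pos_semidef (C \<alpha>) \<and> M \<alpha> ** C \<alpha> + C \<alpha> ** transpose (M \<alpha>) = Q"
    using A(3) C by (auto elim!: eventually_mono simp: stationary_covariance_def Q_def)
  have "((\<lambda>\<alpha>. (xs \<alpha>, \<alpha>)) \<longlongrightarrow> (xc, \<alpha>c)) ?G"
    by (intro tendsto_Pair xc tendsto_ident_at)
  moreover have "\<forall>\<^sub>F \<alpha> in ?G. (xs \<alpha>, \<alpha>) \<in> U"
    using A(3) smooth(2) by (auto elim!: eventually_mono)
  ultimately obtain k where k: "\<forall>\<^sub>F \<alpha> in ?G. \<forall>i j. \<bar>M \<alpha> $ i $ j\<bar> \<le> k"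
    using drift_matrix_locally_bounded[OF smooth(4,3)] unfolding M by blast
  obtain \<kappa> where \<kappa>: "\<kappa> \<ge> 0" "\<And>u. hermitian_form Q u \<le> \<kappa> * (norm u)\<^sup>2"
    using matrix_quadratic_bound by metis
  \<comment> \<open>The drift bound \<open>k\<close>, the gap \<open>\<delta>\<close> and the form
    bound \<open>\<kappa>\<close> are all independent of \<open>\<alpha>\<close>, so one constant
    serves for every parameter close to critical.\<close>
  obtain K where K: "K \<ge> 0" "\<forall>\<^sub>F \<alpha> in ?G. \<forall>u. u \<bullet> v \<alpha> = 0 \<longrightarrow> u \<bullet> (C \<alpha> *v u) \<le> K * (norm u)\<^sup>2"
  proof
    let ?m = "?n * (?n * k)"
    let ?K = "((\<lambda>K. (\<kappa> + (2 * ?m)\<^sup>2 * K / \<delta>) / \<delta>) ^^ (CARD('n) - 1)) 0"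
    show "max 0 ?K \<ge> 0" by simp
    show "\<forall>\<^sub>F \<alpha> in ?G. \<forall>u. u \<bullet> v \<alpha> = 0 \<longrightarrow> u \<bullet> (C \<alpha> *v u) \<le> max 0 ?K * (norm u)\<^sup>2"
      using lyap k diag simple gap(2) eigenvectors
    proof eventually_elim
      case (elim \<alpha>)
      show ?case
      proof (intro allI impI)
        fix u assume "u \<bullet> v \<alpha> = 0"
        then have "u \<bullet> (C \<alpha> *v u) \<le> ?K * (norm u)\<^sup>2"
          using elim gap(1) \<kappa> norm_complex_matrix_mult_le[of "M \<alpha>" k]
          by (intro noncritical_variance_bound[where M = "M \<alpha>" and Q = Q and v = "v \<alpha>" and lam = "lam \<alpha>"]) auto
        also have "\<dots> \<le> max 0 ?K * (norm u)\<^sup>2" by (intro mult_right_mono) auto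
        finally show "u \<bullet> (C \<alpha> *v u) \<le> max 0 ?K * (norm u)\<^sup>2" .
      qed
    qed
  qed
  \<comment> \<open>The critical variance is this quantity divided by \<open>lam \<alpha>\<close>.
    Its limit is half the effective noise intensity, positive by \<open>sigma_eff\<close>, so the
    quotient diverges.\<close>
  have "((\<lambda>\<alpha>. w \<alpha> \<bullet> (Q *v w \<alpha>) / 2) \<longlongrightarrow> wc \<bullet> (Q *v wc) / 2) ?G"
    by (intro tendsto_intros wc bounded_linear.tendsto[OF matrix_vector_mul_bounded_linear]) simp
  moreover have "filterlim (\<lambda>\<alpha>. inverse (lam \<alpha>)) at_top ?G"
    using lam_lim lam_pos by (rule filterlim_inverse_at_top)
  ultimately have lim: "filterlim (\<lambda>\<alpha>. w \<alpha> \<bullet> (Q *v w \<alpha>) / 2 * inverse (lam \<alpha>)) at_top ?G"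
    using sigma_eff by (intro filterlim_tendsto_pos_mult_at_top[where c = "wc \<bullet> (Q *v wc) / 2"]) (auto simp: Q_def)
  have eq: "\<forall>\<^sub>F \<alpha> in ?G. w \<alpha> \<bullet> (Q *v w \<alpha>) / 2 * inverse (lam \<alpha>) = w \<alpha> \<bullet> (C \<alpha> *v w \<alpha>)"
    using lyap eigenvectors lam_pos
  proof eventually_elim
    case (elim \<alpha>)
    then have "w \<alpha> \<bullet> (Q *v w \<alpha>) = 2 * (lam \<alpha> * (w \<alpha> \<bullet> (C \<alpha> *v w \<alpha>)))"
      using lyapunov_quadratic[of "C \<alpha>" "M \<alpha>" Q "w \<alpha>"] by simp
    then show ?case using elim by (simp add: field_simps)
  qed
  have s: "filterlim (\<lambda>\<alpha>. w \<alpha> \<bullet> (C \<alpha> *v w \<alpha>)) at_top ?G"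
    by (rule iffD1[OF filterlim_cong[OF refl refl eq] lim])
  have "\<forall>\<^sub>F \<alpha> in ?G. norm (w \<alpha>) < norm wc + 1"
    by (rule order_tendstoD[OF tendsto_norm[OF wc]]) simp
  with eigenvectors have vw: "\<forall>\<^sub>F \<alpha> in ?G. norm (v \<alpha>) = 1 \<and> w \<alpha> \<bullet> v \<alpha> = 1 \<and> norm (w \<alpha>) \<le> norm wc + 1"
    by eventually_elim auto
  have "(\<mu> \<longlongrightarrow> xc - xs \<alpha>0) ?G"
    unfolding \<mu>_def by (intro tendsto_intros xc)
  then have "\<forall>\<^sub>F \<alpha> in ?G. norm (\<mu> \<alpha>) < norm (xc - xs \<alpha>0) + 1"
    by (intro order_tendstoD[OF tendsto_norm]) auto
  then have \<mu>: "\<forall>\<^sub>F \<alpha> in ?G. norm (\<mu> \<alpha>) \<le> norm (xc - xs \<alpha>0) + 1"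
    by eventually_elim simp
  have P': "\<forall>\<^sub>F \<alpha> in ?G. prob_space (P \<alpha>)"
    and z': "\<forall>\<^sub>F \<alpha> in ?G. multivariate_normal (P \<alpha>) (z \<alpha>) 0 (C \<alpha>)"
    and eps': "\<forall>\<^sub>F \<alpha> in ?G. multivariate_normal (P \<alpha>) (eps \<alpha>) 0 ((1 / real l) *\<^sub>R C \<alpha>0)"
    using A(3) P z eps by (auto elim!: eventually_mono)
  \<comment> \<open>The relative distance of \<open>y\<close> from its critical component is at
    least \<open>\<eta>\<close>. The inequality is not strict, so outside the event
    \<open>w \<bullet> z\<close> is automatically nonzero and may be divided by.\<close>
  define bad where "bad \<eta> \<alpha> = {\<omega> \<in> space (P \<alpha>).
      \<eta> * \<bar>w \<alpha> \<bullet> z \<alpha> \<omega>\<bar> \<le> norm (y \<alpha> \<omega> - (w \<alpha> \<bullet> z \<alpha> \<omega>) *\<^sub>R v \<alpha>)}" for \<eta> \<alpha>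
  have bad_lim: "((\<lambda>\<alpha>. measure (P \<alpha>) (bad \<eta> \<alpha>)) \<longlongrightarrow> 0) ?G" if "\<eta> > 0" for \<eta>
    unfolding bad_def y_eq
    by (rule critical_projection_dominates[OF P' z' eps' K vw \<mu> s that])
  have meas: "\<forall>\<^sub>F \<alpha> in ?G. y \<alpha> \<in> borel_measurable (P \<alpha>) \<and> (\<forall>\<eta>. bad \<eta> \<alpha> \<in> sets (P \<alpha>))"
    using z' eps'
  proof eventually_elim
    case (elim \<alpha>)
    then have [measurable]: "z \<alpha> \<in> borel_measurable (P \<alpha>)" "eps \<alpha> \<in> borel_measurable (P \<alpha>)"
      by (simp_all add: multivariate_normal_def)
    show ?case unfolding bad_def y_eq[abs_def] by (auto; measurable)
  qed
  \<comment> \<open>One half of \<open>\<eta>\<close> covers the relative error of \<open>y\<close>,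
    the other half the distance from \<open>v \<alpha>\<close> to \<open>vc\<close>. The scalar
    \<open>g\<close> then disappears from the coefficient of variation by scale invariance.\<close>
  have near: "\<forall>\<^sub>F \<alpha> in ?G. \<forall>\<omega>\<in>space (P \<alpha>) - bad (\<eta> / 2) \<alpha>. \<exists>u g. g \<noteq> 0 \<and> y \<alpha> \<omega> = g *\<^sub>R u \<and> dist u vc < \<eta>"
    if \<eta>: "\<eta> > 0" for \<eta>
  proof -
    have "\<forall>\<^sub>F \<alpha> in ?G. dist (v \<alpha>) vc < \<eta> / 2" using vc \<eta> by (intro tendstoD) auto
    then show ?thesis
    proof eventually_elim
      case (elim \<alpha>)
      show ?case
      proof
        fix \<omega> assume \<omega>: "\<omega> \<in> space (P \<alpha>) - bad (\<eta> / 2) \<alpha>"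
        define g where "g = w \<alpha> \<bullet> z \<alpha> \<omega>"
        have less: "norm (y \<alpha> \<omega> - g *\<^sub>R v \<alpha>) < \<eta> / 2 * \<bar>g\<bar>"
          using \<omega> by (auto simp: bad_def g_def)
        then have g: "g \<noteq> 0" by auto
        have "(1 / g) *\<^sub>R y \<alpha> \<omega> - v \<alpha> = (1 / g) *\<^sub>R (y \<alpha> \<omega> - g *\<^sub>R v \<alpha>)"
          using g by (simp add: algebra_simps)
        then have "dist ((1 / g) *\<^sub>R y \<alpha> \<omega>) (v \<alpha>) = norm (y \<alpha> \<omega> - g *\<^sub>R v \<alpha>) / \<bar>g\<bar>"
          by (simp add: dist_norm)
        also have "\<dots> < \<eta> / 2" using less g by (simp add: field_simps)
        finally have "dist ((1 / g) *\<^sub>R y \<alpha> \<omega>) vc < \<eta>"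
          using elim dist_triangle[of "(1 / g) *\<^sub>R y \<alpha> \<omega>" vc "v \<alpha>"] by linarith
        then show "\<exists>u g. g \<noteq> 0 \<and> y \<alpha> \<omega> = g *\<^sub>R u \<and> dist u vc < \<eta>"
          using g by (intro exI[of _ "(1 / g) *\<^sub>R y \<alpha> \<omega>"] exI[of _ g]) simp
      qed
    qed
  qed
  have finite_limit: "tendsto_in_prob P (\<lambda>\<alpha> \<omega>. coeff_var (y \<alpha> \<omega>)) (coeff_var vc) ?G" if nz: "avg vc \<noteq> 0"
    unfolding tendsto_in_prob_def
  proof (intro allI impI)
    fix e :: real assume "e > 0"
    then obtain \<eta> where \<eta>: "\<eta> > 0" "\<And>u. dist u vc < \<eta> \<Longrightarrow> dist (coeff_var u) (coeff_var vc) < e"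
      using isCont_coeff_var[OF nz] unfolding continuous_at_eps_delta by blast
    have "\<forall>\<^sub>F \<alpha> in ?G. measure (P \<alpha>) {\<omega> \<in> space (P \<alpha>). \<bar>coeff_var (y \<alpha> \<omega>) - coeff_var vc\<bar> > e}
        \<le> measure (P \<alpha>) (bad (\<eta> / 2) \<alpha>)"
      using near[OF \<eta>(1)] P' meas
    proof eventually_elim
      case (elim \<alpha>)
      interpret prob_space "P \<alpha>" by (rule elim(2))
      have "\<bar>coeff_var (y \<alpha> \<omega>) - coeff_var vc\<bar> < e" if \<omega>: "\<omega> \<in> space (P \<alpha>) - bad (\<eta> / 2) \<alpha>" for \<omega>
      proof -
        obtain u g where "g \<noteq> 0" "y \<alpha> \<omega> = g *\<^sub>R u" "dist u vc < \<eta>" using elim(1) \<omega> by blast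
        then show ?thesis using \<eta>(2)[of u] by (simp add: coeff_var_scaleR dist_real_def)
      qed
      then have "{\<omega> \<in> space (P \<alpha>). \<bar>coeff_var (y \<alpha> \<omega>) - coeff_var vc\<bar> > e} \<subseteq> bad (\<eta> / 2) \<alpha>"
        by force
      then show ?case using elim(3) by (intro finite_measure_mono) auto
    qed
    then show "((\<lambda>\<alpha>. measure (P \<alpha>) {\<omega> \<in> space (P \<alpha>). \<bar>coeff_var (y \<alpha> \<omega>) - coeff_var vc\<bar> > e}) \<longlongrightarrow> 0) ?G"
      using \<eta>(1) by (intro tendsto_sandwich[OF _ _ tendsto_const bad_lim[of "\<eta> / 2"]]) auto
  qed
  have infinite_limit: "tendsto_infinity_in_prob P (\<lambda>\<alpha> \<omega>. coeff_var (y \<alpha> \<omega>)) ?G"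
    if "avg vc = 0" "sample_var vc > 0"
    unfolding tendsto_infinity_in_prob_def
  proof
    fix L :: real
    \<comment> \<open>Half the limiting standard deviation is a lower bound for the numerator near
      \<open>vc\<close>. The factor \<open>\<bar>L\<bar> + 1\<close> in the bound on the mean is
      positive for every sign of \<open>L\<close>.\<close>
    define c where "c = sqrt (sample_var vc) / 2"
    have c: "c > 0" using that by (simp add: c_def)
    have "\<forall>\<^sub>F u in nhds vc. sqrt (sample_var u) > c"
      using that isCont_sample_var[of vc] unfolding isCont_def tendsto_at_iff_tendsto_nhds
      by (intro order_tendstoD(1)[OF tendsto_real_sqrt]) (auto simp: c_def)
    moreover have "\<forall>\<^sub>F u in nhds vc. \<bar>avg u\<bar> < c / (\<bar>L\<bar> + 1)"
      using that c tendsto_rabs[OF isCont_avg[of vc, unfolded isCont_def tendsto_at_iff_tendsto_nhds]]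
      by (intro order_tendstoD(2)[where y = 0]) auto
    \<comment> \<open>The exception matters because division by zero yields 0, so
      \<open>coeff_var\<close> vanishes at vectors of mean zero, however close to \<open>vc\<close>.
      In the probability estimate this exception is the null event supplied by
      \<open>y_nonzero\<close>.\<close>
    ultimately have "\<forall>\<^sub>F u in nhds vc. avg u \<noteq> 0 \<longrightarrow> coeff_var u > L"
    proof eventually_elim
      case (elim u)
      show ?case
      proof
        assume u: "avg u \<noteq> 0"
        have "L * \<bar>avg u\<bar> \<le> (\<bar>L\<bar> + 1) * \<bar>avg u\<bar>" by (intro mult_right_mono) auto
        also have "\<dots> < c" using elim(2) by (simp add: field_simps)
        also have "\<dots> < sqrt (sample_var u)" by (rule elim(1))
        finally show "coeff_var u > L" using u by (simp add: coeff_var_def field_simps)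
      qed
    qed
    then obtain \<eta> where \<eta>: "\<eta> > 0" "\<And>u. dist u vc < \<eta> \<Longrightarrow> avg u \<noteq> 0 \<Longrightarrow> coeff_var u > L"
      unfolding eventually_nhds_metric by blast
    have lower: "\<forall>\<^sub>F \<alpha> in ?G. 1 - measure (P \<alpha>) (bad (\<eta> / 2) \<alpha>)
        \<le> measure (P \<alpha>) {\<omega> \<in> space (P \<alpha>). coeff_var (y \<alpha> \<omega>) > L}"
      using near[OF \<eta>(1)] P' meas y_nonzero
    proof eventually_elim
      case (elim \<alpha>)
      interpret prob_space "P \<alpha>" by (rule elim(2))
      have y[measurable]: "y \<alpha> \<in> borel_measurable (P \<alpha>)" and bad[measurable]: "bad (\<eta> / 2) \<alpha> \<in> sets (P \<alpha>)"
        using elim(3) by auto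
      let ?Z = "{\<omega> \<in> space (P \<alpha>). avg (y \<alpha> \<omega>) = 0}" and ?L = "{\<omega> \<in> space (P \<alpha>). coeff_var (y \<alpha> \<omega>) > L}"
      have Z: "?Z \<in> sets (P \<alpha>)" and L: "?L \<in> sets (P \<alpha>)" by measurable
      have "\<omega> \<in> ?L" if \<omega>: "\<omega> \<in> space (P \<alpha>) - bad (\<eta> / 2) \<alpha>" "avg (y \<alpha> \<omega>) \<noteq> 0" for \<omega>
      proof -
        obtain u g where u: "g \<noteq> 0" "y \<alpha> \<omega> = g *\<^sub>R u" "dist u vc < \<eta>" using elim(1) \<omega>(1) by blast
        moreover have "avg u \<noteq> 0" using \<omega>(2) u(2) by (auto simp: avg_scaleR)
        ultimately show ?thesis using \<eta>(2) \<omega>(1) by (simp add: coeff_var_scaleR)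
      qed
      \<comment> \<open>The whole space is covered by the desired event, the bad event and the null
        event, so subadditivity gives the lower bound.\<close>
      then have "space (P \<alpha>) \<subseteq> ?L \<union> (bad (\<eta> / 2) \<alpha> \<union> ?Z)" by blast
      then have "1 \<le> prob (?L \<union> (bad (\<eta> / 2) \<alpha> \<union> ?Z))"
        using finite_measure_mono[of "space (P \<alpha>)" "?L \<union> (bad (\<eta> / 2) \<alpha> \<union> ?Z)"] bad Z L by (simp add: prob_space sets.Un)
      also have "\<dots> \<le> prob ?L + prob (bad (\<eta> / 2) \<alpha> \<union> ?Z)"
        using bad Z L by (intro measure_Un_le) auto
      also have "prob (bad (\<eta> / 2) \<alpha> \<union> ?Z) \<le> prob (bad (\<eta> / 2) \<alpha>) + prob ?Z"
        using bad Z by (intro measure_Un_le) auto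
      finally show ?case using elim(4) by simp
    qed
    have upper: "\<forall>\<^sub>F \<alpha> in ?G. measure (P \<alpha>) {\<omega> \<in> space (P \<alpha>). coeff_var (y \<alpha> \<omega>) > L} \<le> 1"
      using P' by eventually_elim (rule prob_space.prob_le_1)
    have lim1: "((\<lambda>\<alpha>. 1 - measure (P \<alpha>) (bad (\<eta> / 2) \<alpha>)) \<longlongrightarrow> 1) ?G"
      using tendsto_diff[OF tendsto_const bad_lim[of "\<eta> / 2"], of 1] \<eta>(1) by simp
    show "((\<lambda>\<alpha>. measure (P \<alpha>) {\<omega> \<in> space (P \<alpha>). coeff_var (y \<alpha> \<omega>) > L}) \<longlongrightarrow> 1) ?G"
      by (rule tendsto_sandwich[OF lower upper lim1 tendsto_const])
  qed
  have "\<forall>\<^sub>F \<alpha> in ?G. norm (v \<alpha>) = 1" using eigenvectors by eventually_elim simp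
  then have "norm vc = 1"
    using tendsto_unique[OF trivial_limit_at_left_real tendsto_norm[OF vc] tendsto_eventually] by simp
  have \<rho>: "\<rho>c = ?n * (avg vc)\<^sup>2"
    by (simp add: rho avg_def power2_eq_square)
  have var: "sample_var vc = (1 - \<rho>c) / (?n - 1)"
    using sample_var_eq[of vc] \<open>norm vc = 1\<close> by (simp add: \<rho>)
  have n: "?n > 1" using N by simp
  have cv: "coeff_var vc = sqrt (?n * (1 - \<rho>c) / ((?n - 1) * \<rho>c))"
  proof -
    have "coeff_var vc = sqrt (sample_var vc / (avg vc)\<^sup>2)"
      by (simp add: coeff_var_def real_sqrt_divide)
    also have "sample_var vc / (avg vc)\<^sup>2 = ?n * (1 - \<rho>c) / ((?n - 1) * \<rho>c)"
    proof -
      have "(avg vc)\<^sup>2 = \<rho>c / ?n" by (simp add: \<rho>)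
      then show ?thesis unfolding var by (simp add: mult_ac)
    qed
    finally show ?thesis .
  qed
  show ?thesis
  proof (intro conjI impI)
    assume "0 < \<rho>c \<and> \<rho>c < 1"
    then show "tendsto_in_prob P (\<lambda>\<alpha> \<omega>. coeff_var (y \<alpha> \<omega>)) (sqrt (?n * (1 - \<rho>c) / ((?n - 1) * \<rho>c))) ?G"
      unfolding cv[symmetric] by (intro finite_limit) (auto simp: \<rho>)
  next
    \<comment> \<open>The formula \<open>cv\<close> evaluates to 0 here, so this case is another
      instance of the finite limit.\<close>
    assume 1: "\<rho>c = 1"
    then have "avg vc \<noteq> 0" by (auto simp: \<rho>)
    then show "tendsto_in_prob P (\<lambda>\<alpha> \<omega>. coeff_var (y \<alpha> \<omega>)) 0 ?G"
      using finite_limit cv 1 by simp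
  next
    \<comment> \<open>The limit direction has mean zero and unit norm, so its sample variance is
      \<open>1 / (?n - 1)\<close>, which is positive as \<open>?n > 1\<close>.\<close>
    assume "\<rho>c = 0"
    then show "tendsto_infinity_in_prob P (\<lambda>\<alpha> \<omega>. coeff_var (y \<alpha> \<omega>)) ?G"
      using n var by (intro infinite_limit) (auto simp: \<rho>)
  qed
qed

end
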